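(* Let $(T_0,\widetilde{T}_0)$ be a joint pair of abstract Friedrichs operators on a complex Hilbert space $\mathcal{H}$. There exists a closed subspace $\mathcal{V}$ of $\mathcal{W}$ with $\mathcal{W}_0\subseteq\mathcal{V}$ and such that $(T_1|_{\mathcal{V}},\widetilde{T}_1|_{\mathcal{V}})$ is a pair of mutually adjoint bijective realisations related to $(T_0,\widetilde{T}_0)$ if and only if $\ker T_1$ and $\ker\widetilde{T}_1$ are isomorphic.
   Context: $\langle\cdot\mid\cdot\rangle$ is the scalar product of $\mathcal{H}$, anti-linear in the second entry. A joint pair of abstract Friedrichs operators is a pair $(T_0,\widetilde{T}_0)$ of linear operators on $\mathcal{H}$ such that: (T1) they have a common domain $\mathcal{D}$, dense in $\mathcal{H}$, and $\langle T_0\phi\mid\psi\rangle=\langle\phi\mid\widetilde{T}_0\psi\rangle$ for $\phi,\psi\in\mathcal{D}$; (T2) there is $\lambda>0$ with $\|(T_0+\widetilde{T}_0)\phi\|\le2\lambda\|\phi\|$ for $\phi\in\mathcal{D}$; (T3) there is $\mu>0$ with $\langle(T_0+\widetilde{T}_0)\phi\mid\phi\rangle\ge2\mu\|\phi\|^2$ for $\phi\in\mathcal{D}$. Notation: $T_1:=\widetilde{T}_0^*$, $\widetilde{T}_1:=T_0^*$; $\mathcal{W}_0:=\operatorname{dom}\overline{T}_0=\operatorname{dom}\overline{\widetilde{T}}_0$ and $\mathcal{W}:=\operatorname{dom}T_1=\operatorname{dom}\widetilde{T}_1$ (these equalities are known to hold). $\mathcal{W}$ carries the graph norm $\|u\|_{T_1}=\|u\|+\|T_1u\|$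 (equivalent to the graph norm of $\widetilde{T}_1$), and "closed subspace of $\mathcal{W}$" refers to it. "Mutually adjoint" means $(T_1|_{\mathcal{V}})^*=\widetilde{T}_1|_{\mathcal{V}}$ and $(\widetilde{T}_1|_{\mathcal{V}})^*=T_1|_{\mathcal{V}}$; "bijective realisations" means that $T_1|_{\mathcal{V}}:\mathcal{V}\to\mathcal{H}$ and $\widetilde{T}_1|_{\mathcal{V}}:\mathcal{V}\to\mathcal{H}$ are bijective. Two Hilbert spaces are isomorphic if there is a linear surjective isometry between them; $\ker T_1$ and $\ker\widetilde{T}_1$ are regarded as (closed) subspaces of $\mathcal{H}$. *)

theory Defs
  imports "HOL-Analysis.Analysis"
begin

text \<open>The class extends \<open>banach\<close>, so norm, topology and completeness are the library's; the last
  two axioms tie them to the complex structure. The scalar product is anti-linear in its second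
  argument.\<close>

class complex_hilbert = banach +
  fixes scaleC :: "complex \<Rightarrow> 'a \<Rightarrow> 'a" (infixr "*\<^sub>C" 75)
    and cinner :: "'a \<Rightarrow> 'a \<Rightarrow> complex"
  assumes scaleC_add_right: "c *\<^sub>C (x + y) = c *\<^sub>C x + c *\<^sub>C y"
    and scaleC_add_left: "(c + d) *\<^sub>C x = c *\<^sub>C x + d *\<^sub>C x"
    and scaleC_scaleC: "c *\<^sub>C d *\<^sub>C x = (c * d) *\<^sub>C x"
    and scaleC_one: "1 *\<^sub>C x = x"
    and cinner_add_left: "cinner (x + y) z = cinner x z + cinner y z"
    and cinner_scaleC_left: "cinner (c *\<^sub>C x) y = c * cinner x y"
    and cinner_commute: "cinner x y = cnj (cinner y x)"
    and scaleR_scaleC: "r *\<^sub>R x = complex_of_real r *\<^sub>C x"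
    and cinner_self: "cinner x x = complex_of_real ((norm x)\<^sup>2)"

global_interpretation complex_hilbert: vector_space "scaleC :: complex \<Rightarrow> 'a \<Rightarrow> 'a::complex_hilbert"
  by unfold_locales
    (simp_all add: scaleC_add_right scaleC_add_left scaleC_scaleC scaleC_one)

instantiation complex :: complex_hilbert
begin

definition scaleC_complex :: "complex \<Rightarrow> complex \<Rightarrow> complex"
  where "scaleC_complex c x = c * x"

definition cinner_complex :: "complex \<Rightarrow> complex \<Rightarrow> complex"
  where "cinner_complex x y = x * cnj y"

instance
  by standard
    (simp_all add: scaleC_complex_def cinner_complex_def algebra_simps scaleR_conv_of_real
      complex_norm_square[symmetric] del: of_real_power)

end

abbreviation csubspace :: "'a::complex_hilbert set \<Rightarrow> bool"
  where "csubspace \<equiv> module.subspace scaleC"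

text \<open>An unbounded operator is a partial function, so that equality of operators includes equality
  of their domains and restriction is \<open>restrict_map\<close>.\<close>

type_synonym 'a operator = "'a \<rightharpoonup> 'a"

definition linear_operator :: "'a::complex_hilbert operator \<Rightarrow> bool"
  where "linear_operator T \<longleftrightarrow> csubspace (dom T) \<and>
    (\<forall>u\<in>dom T. \<forall>v\<in>dom T. the (T (u + v)) = the (T u) + the (T v)) \<and>
    (\<forall>c. \<forall>u\<in>dom T. the (T (c *\<^sub>C u)) = c *\<^sub>C the (T u))"

definition op_kernel :: "'a::complex_hilbert operator \<Rightarrow> 'a set"
  where "op_kernel T = {u \<in> dom T. the (T u) = 0}"

text \<open>Meaningful for densely defined \<open>T\<close>, where \<open>w\<close> is unique whenever it exists.\<close>

definition adjoint_op :: "'a::complex_hilbert operator \<Rightarrow> 'a operator"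
  where "adjoint_op T = (\<lambda>v.
    if \<exists>w. \<forall>u\<in>dom T. cinner (the (T u)) v = cinner u w
    then Some (THE w. \<forall>u\<in>dom T. cinner (the (T u)) v = cinner u w)
    else None)"

lemma adjoint_op_eq_Some_iff:
  assumes "closure (dom T) = UNIV"
  shows "adjoint_op T v = Some w \<longleftrightarrow> (\<forall>u\<in>dom T. cinner (the (T u)) v = cinner u w)"
proof -
  have uniq: "w = w'"
    if w: "\<forall>u\<in>dom T. cinner (the (T u)) v = cinner u w"
      and w': "\<forall>u\<in>dom T. cinner (the (T u)) v = cinner u w'" for w w'
  proof -
    define x where "x = w - w'"
    have sub: "cinner u (a - b) = cinner u a - cinner u b" for u a b :: 'a
    proof -
      have "cinner u (a - b) + cinner u b = cinner u a"
        using arg_cong[OF cinner_add_left[of "a - b" b u], of cnj]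
        by (simp add: cinner_commute[symmetric])
      then show ?thesis by (simp add: algebra_simps)
    qed
    have ortho: "cinner u x = 0" if "u \<in> dom T" for u
      using w w' that by (simp add: x_def sub)
    have far: "norm x \<le> norm (u - x)" if u: "u \<in> dom T" for u
    proof -
      have ux: "cinner u x = 0" "cinner x u = 0"
        using ortho[OF u] cinner_commute[of x u] by auto
      have "cinner (u - x) (u - x) = cinner (u - x) u - cinner (u - x) x" by (rule sub)
      also have "\<dots> = cnj (cinner u (u - x)) - cnj (cinner x (u - x))"
        by (simp only: cinner_commute[of "u - x"])
      also have "\<dots> = cinner u u + cinner x x"
        using ux by (simp add: sub cinner_self)
      finally have "(norm (u - x))\<^sup>2 = (norm u)\<^sup>2 + (norm x)\<^sup>2"
        unfolding cinner_self of_real_add[symmetric] of_real_eq_iff .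
      then have "(norm x)\<^sup>2 \<le> (norm (u - x))\<^sup>2" by simp
      then show ?thesis by (rule power2_le_imp_le) simp
    qed
    have "x = 0"
    proof (rule ccontr)
      assume "x \<noteq> 0"
      then obtain u where "u \<in> dom T" "dist u x < norm x"
        using assms closure_approachable[of x "dom T"] by (metis UNIV_I zero_less_norm_iff)
      then show False using far[of u] by (simp add: dist_norm)
    qed
    then show ?thesis by (simp add: x_def)
  qed
  show ?thesis
  proof
    assume "adjoint_op T v = Some w"
    then obtain w' where w': "\<forall>u\<in>dom T. cinner (the (T u)) v = cinner u w'"
        and w: "w = (THE w. \<forall>u\<in>dom T. cinner (the (T u)) v = cinner u w)"
      unfolding adjoint_op_def by (auto split: if_splits)
    show "\<forall>u\<in>dom T. cinner (the (T u)) v = cinner u w"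
      unfolding w by (rule theI[of _ w']) (use w' uniq in blast)+
  next
    assume w: "\<forall>u\<in>dom T. cinner (the (T u)) v = cinner u w"
    then have "(THE w. \<forall>u\<in>dom T. cinner (the (T u)) v = cinner u w) = w"
      using uniq by (intro the_equality) blast+
    then show "adjoint_op T v = Some w"
      unfolding adjoint_op_def using w by auto
  qed
qed

text \<open>Meaningful for closable \<open>T\<close>, where the closure of the graph is again a graph.\<close>

definition closure_op :: "'a::complex_hilbert operator \<Rightarrow> 'a operator"
  where "closure_op T = (\<lambda>u.
    if \<exists>w. (u, w) \<in> closure (Map.graph T)
    then Some (THE w. (u, w) \<in> closure (Map.graph T))
    else None)"

definition joint_abstract_friedrichs ::
    "'a::complex_hilbert operator \<Rightarrow> 'a operator \<Rightarrow> bool"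
  where "joint_abstract_friedrichs T S \<longleftrightarrow>
    linear_operator T \<and> linear_operator S \<and>
    dom T = dom S \<and> closure (dom T) = UNIV \<and>
    (\<forall>\<phi>\<in>dom T. \<forall>\<psi>\<in>dom T. cinner (the (T \<phi>)) \<psi> = cinner \<phi> (the (S \<psi>))) \<and>
    (\<exists>l>0. \<forall>\<phi>\<in>dom T. norm (the (T \<phi>) + the (S \<phi>)) \<le> 2 * l * norm \<phi>) \<and>
    (\<exists>m>0. \<forall>\<phi>\<in>dom T. cinner (the (T \<phi>) + the (S \<phi>)) \<phi> \<in> \<real> \<and>
       Re (cinner (the (T \<phi>) + the (S \<phi>)) \<phi>) \<ge> 2 * m * (norm \<phi>)\<^sup>2)"

definition graph_norm :: "'a::complex_hilbert operator \<Rightarrow> 'a \<Rightarrow> real"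
  where "graph_norm T u = norm u + norm (the (T u))"

lemma Metric_space_graph_norm:
  assumes "linear_operator T"
  shows "Metric_space (dom T) (\<lambda>u v. graph_norm T (u - v))"
proof -
  have sub: "csubspace (dom T)"
    and add: "\<And>u v. u \<in> dom T \<Longrightarrow> v \<in> dom T \<Longrightarrow> the (T (u + v)) = the (T u) + the (T v)"
    and sc: "\<And>c u. u \<in> dom T \<Longrightarrow> the (T (c *\<^sub>C u)) = c *\<^sub>C the (T u)"
    using assms unfolding linear_operator_def by blast+
  have neg: "the (T (- u)) = - the (T u)" if "u \<in> dom T" for u
    using sc[OF that, of "- 1"] by simp
  have comm: "graph_norm T (u - v) = graph_norm T (v - u)" for u v
  proof (cases "u - v \<in> dom T")
    case True
    then show ?thesis
      using neg[OF True] by (simp add: graph_norm_def norm_minus_commute)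
  next
    case False
    then have "v - u \<notin> dom T"
      using complex_hilbert.subspace_neg[OF sub, of "v - u"] by auto
    with False have "T (u - v) = None" "T (v - u) = None" by auto
    then show ?thesis by (simp add: graph_norm_def norm_minus_commute)
  qed
  have zero: "the (T 0) = 0"
    using sc[OF complex_hilbert.subspace_0[OF sub], of 0] by simp
  show ?thesis
  proof
    fix u v w
    assume "u \<in> dom T" "v \<in> dom T" "w \<in> dom T"
    then have d: "u - v \<in> dom T" "v - w \<in> dom T"
      using complex_hilbert.subspace_diff[OF sub] by blast+
    then have "the (T (u - w)) = the (T (u - v)) + the (T (v - w))"
      using add[OF d] by simp
    then show "graph_norm T (u - w) \<le> graph_norm T (u - v) + graph_norm T (v - w)"
      unfolding graph_norm_def
      using norm_triangle_ineq[of "u - v" "v - w"]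
        norm_triangle_ineq[of "the (T (u - v))" "the (T (v - w))"] by simp
  qed (use comm zero in \<open>auto simp: graph_norm_def add_nonneg_eq_0_iff\<close>)
qed

text \<open>Closed subspaces of \<open>dom T\<close> with respect to the graph norm of \<open>T\<close>; \<open>V \<subseteq> dom T\<close> is part of
  \<open>closedin\<close>.\<close>

definition closed_graph_subspace :: "'a::complex_hilbert operator \<Rightarrow> 'a set \<Rightarrow> bool"
  where "closed_graph_subspace T V \<longleftrightarrow> csubspace V \<and>
    closedin (Metric_space.mtopology (dom T) (\<lambda>u v. graph_norm T (u - v))) V"

definition mutually_adjoint :: "'a::complex_hilbert operator \<Rightarrow> 'a operator \<Rightarrow> bool"
  where "mutually_adjoint T S \<longleftrightarrow> adjoint_op T = S \<and> adjoint_op S = T"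

definition bijective_from :: "'a::complex_hilbert set \<Rightarrow> 'a operator \<Rightarrow> bool"
  where "bijective_from V T \<longleftrightarrow> dom T = V \<and> bij_betw (\<lambda>u. the (T u)) V UNIV"

definition isomorphic_subspaces :: "'a::complex_hilbert set \<Rightarrow> 'a set \<Rightarrow> bool"
  where "isomorphic_subspaces K L \<longleftrightarrow> (\<exists>U :: 'a \<Rightarrow> 'a.
    (\<forall>x\<in>K. \<forall>y\<in>K. U (x + y) = U x + U y) \<and>
    (\<forall>c. \<forall>x\<in>K. U (c *\<^sub>C x) = c *\<^sub>C U x) \<and>
    (\<forall>x\<in>K. norm (U x) = norm x) \<and>
    U ` K = L)"

end

theory Submission
  imports Defs
begin

text \<open>The sum \<open>T\<^sub>0 + T\<^sub>0'\<close> extends to a bounded positive definite operator \<open>B\<close>, and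
  \<open>T\<^sub>1' = B - T\<^sub>1\<close>. A domain \<open>V\<close> gives mutually adjoint bijective realisations iff it is its own
  orthogonal complement for the boundary form \<open>\<langle>T\<^sub>1 u | v\<rangle> - \<langle>u | T\<^sub>1' v\<rangle>\<close>. Such a \<open>V\<close> is \<open>W\<^sub>0\<close> plus the
  graph of a bijection \<open>ker T\<^sub>1 \<rightarrow> ker T\<^sub>1'\<close> which is isometric for \<open>\<langle>B u | v\<rangle>\<close>: given \<open>a\<close> in
  \<open>ker T\<^sub>1\<close>, its image is \<open>v - a\<close> for the \<open>v\<close> in \<open>V\<close> with \<open>T\<^sub>1' v = T\<^sub>1' a\<close>. Conversely, such a
  graph works because the whole space is \<open>ran (closure T\<^sub>0) + B (ker T\<^sub>1')\<close>. Square roots of the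
  compressions of \<open>B\<close> to the kernels turn isometries for \<open>\<langle>B u | v\<rangle>\<close> into isometries for the norm.\<close>

section \<open>Complex Hilbert spaces\<close>

lemma cinner_add_right: "cinner x (y + z) = cinner x y + cinner x z"
  for x :: "'a::complex_hilbert"
  by (metis cinner_add_left cinner_commute complex_cnj_add)

lemma cinner_scaleC_right: "cinner x (c *\<^sub>C y) = cnj c * cinner x y"
  for x :: "'a::complex_hilbert"
  by (metis cinner_scaleC_left cinner_commute complex_cnj_mult)

lemma norm_scaleC: "norm (c *\<^sub>C x) = cmod c * norm x"
  for x :: "'a::complex_hilbert"
proof -
  have "complex_of_real ((norm (c *\<^sub>C x))\<^sup>2) = (c * cnj c) * cinner x x"
    unfolding cinner_self[symmetric] by (simp add: cinner_scaleC_left cinner_scaleC_right)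
  also have "\<dots> = complex_of_real ((cmod c * norm x)\<^sup>2)"
    by (simp add: cinner_self complex_norm_square power_mult_distrib del: of_real_power)
  finally have "(norm (c *\<^sub>C x))\<^sup>2 = (cmod c * norm x)\<^sup>2"
    unfolding of_real_eq_iff .
  then show ?thesis by simp
qed

lemma norm_sum_squared: "(norm (x + y))\<^sup>2 = (norm x)\<^sup>2 + 2 * Re (cinner x y) + (norm y)\<^sup>2"
  for x :: "'a::complex_hilbert"
proof -
  have "Re (cinner (x + y) (x + y)) = Re (cinner x x) + 2 * Re (cinner x y) + Re (cinner y y)"
    using arg_cong[OF cinner_commute[of y x], of Re]
    by (simp add: cinner_add_left cinner_add_right)
  then show ?thesis by (simp add: cinner_self)
qed

lemma norm_cinner_le: "cmod (cinner x y) \<le> norm x * norm y"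
  for x :: "'a::complex_hilbert"
proof (cases "y = 0")
  case True
  have "cinner x (0::'a) = 0"
    using cinner_add_right[of x 0 0] by simp
  with True show ?thesis by simp
next
  case False
  \<comment> \<open>This coefficient makes \<open>x + c *\<^sub>C y\<close> the component of
    \<open>x\<close> orthogonal to \<open>y\<close>; its squared norm being nonnegative is the
    claim.\<close>
  define c where "c = - (cinner x y / complex_of_real ((norm y)\<^sup>2))"
  have n: "norm y > 0" using False by simp
  have "cnj c * cinner x y = - complex_of_real ((cmod (cinner x y))\<^sup>2 / (norm y)\<^sup>2)"
    by (simp add: c_def complex_norm_square mult.commute del: of_real_power)
  then have "Re (cinner x (c *\<^sub>C y)) = - ((cmod (cinner x y))\<^sup>2 / (norm y)\<^sup>2)"
    by (simp only: cinner_scaleC_right Re_complex_of_real uminus_complex.sel)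
  moreover have "norm (c *\<^sub>C y) = cmod (cinner x y) / norm y"
    using n by (simp add: norm_scaleC c_def norm_divide norm_mult power2_eq_square)
  ultimately have "(norm (x + c *\<^sub>C y))\<^sup>2 = (norm x)\<^sup>2 - (cmod (cinner x y) / norm y)\<^sup>2"
    by (simp add: norm_sum_squared power_divide)
  then have "(cmod (cinner x y) / norm y)\<^sup>2 \<le> (norm x)\<^sup>2"
    by (metis zero_le_power2 diff_ge_0_iff_ge)
  then have "cmod (cinner x y) / norm y \<le> norm x"
    by (rule power2_le_imp_le) simp
  with n show ?thesis by (simp add: field_simps)
qed

lemma bounded_bilinear_cinner:
  "bounded_bilinear (cinner :: 'a::complex_hilbert \<Rightarrow> 'a \<Rightarrow> complex)"
proof
  show "\<exists>K. \<forall>a b :: 'a. norm (cinner a b) \<le> norm a * norm b * K"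
    by (intro exI[of _ 1]) (simp add: norm_cinner_le)
qed (simp_all add: cinner_add_left cinner_add_right cinner_scaleC_left cinner_scaleC_right
      scaleR_scaleC[where 'a = 'a] scaleR_conv_of_real)

interpretation cinner: bounded_bilinear "cinner :: 'a::complex_hilbert \<Rightarrow> 'a \<Rightarrow> complex"
  by (rule bounded_bilinear_cinner)

lemma bounded_linear_scaleC: "bounded_linear (\<lambda>x :: 'a::complex_hilbert. c *\<^sub>C x)"
proof
  show "\<exists>K. \<forall>x :: 'a. norm (c *\<^sub>C x) \<le> norm x * K"
    by (intro exI[of _ "cmod c"]) (simp add: norm_scaleC)
qed (simp_all add: scaleC_add_right scaleR_scaleC scaleC_scaleC mult.commute)

lemma cinner_ext:
  fixes x y :: "'a::complex_hilbert"
  assumes "\<And>z. cinner x z = cinner y z"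
  shows "x = y"
proof -
  have "cinner (x - y) (x - y) = 0" using assms by (simp add: cinner.diff_left)
  then show ?thesis by (simp add: cinner_self)
qed

lemma Re_cinner_commute: "Re (cinner x y) = Re (cinner y x)"
  for x :: "'a::complex_hilbert"
  by (subst cinner_commute) simp

lemma csubspace_scaleR: "csubspace K \<Longrightarrow> x \<in> K \<Longrightarrow> r *\<^sub>R x \<in> K"
  unfolding scaleR_scaleC by (rule complex_hilbert.subspace_scale)

text \<open>Polarization: the norm of a sum determines the real part of the scalar product, and
  replacing \<open>y\<close> by \<open>\<i> *\<^sub>C y\<close> turns the imaginary part into a real
  part.\<close>

lemma linear_isometry_cinner:
  fixes U :: "'a::complex_hilbert \<Rightarrow> 'b::complex_hilbert"
  assumes K: "csubspace K"
    and add: "\<And>x y. x \<in> K \<Longrightarrow> y \<in> K \<Longrightarrow> U (x + y) = U x + U y"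
    and scale: "\<And>c x. x \<in> K \<Longrightarrow> U (c *\<^sub>C x) = c *\<^sub>C U x"
    and norm: "\<And>x. x \<in> K \<Longrightarrow> norm (U x) = norm x"
    and xy: "x \<in> K" "y \<in> K"
  shows "cinner (U x) (U y) = cinner x y"
proof -
  have Re: "Re (cinner (U a) (U b)) = Re (cinner a b)" if "a \<in> K" "b \<in> K" for a b
    using norm_sum_squared[of a b] norm_sum_squared[of "U a" "U b"] that
      norm[OF complex_hilbert.subspace_add[OF K that]] by (simp add: add norm)
  have "Re (cinner (U x) (U (\<i> *\<^sub>C y))) = Re (cinner x (\<i> *\<^sub>C y))"
    using xy complex_hilbert.subspace_scale[OF K] by (intro Re)
  with xy have "Im (cinner (U x) (U y)) = Im (cinner x y)"
    by (simp add: scale cinner_scaleC_right)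
  with Re[OF xy] show ?thesis by (rule complex_eqI)
qed

subsection \<open>Orthogonal projections\<close>

text \<open>A minimising sequence for the distance to \<open>K\<close> is Cauchy by the
  parallelogram law. At its limit the residual is orthogonal to \<open>K\<close>, since otherwise a
  step inside \<open>K\<close> would come closer to \<open>x\<close>.\<close>

lemma ex_orthogonal_projection:
  fixes K :: "'a::complex_hilbert set"
  assumes K: "csubspace K" "closed K"
  shows "\<exists>p\<in>K. \<forall>k\<in>K. cinner (x - p) k = 0"
proof -
  define f where "f k = (norm (x - k))\<^sup>2" for k
  define d where "d = Inf (f ` K)"
  have ne: "K \<noteq> {}" using complex_hilbert.subspace_0[OF K(1)] by auto
  have bdd: "bdd_below (f ` K)" by (rule bdd_belowI[of _ 0]) (auto simp: f_def)
  have d_le: "d \<le> f k" if "k \<in> K" for k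
    unfolding d_def using that bdd by (auto intro: cInf_lower)
  have "\<exists>k\<in>K. f k < d + inverse (real (Suc n))" for n
  proof -
    have "Inf (f ` K) < d + inverse (real (Suc n))" by (simp add: d_def)
    then show ?thesis using cInf_lessD[of "f ` K"] ne by auto
  qed
  then obtain p where p: "\<And>n. p n \<in> K" "\<And>n. f (p n) < d + inverse (real (Suc n))"
    by metis
  \<comment> \<open>Parallelogram law: the midpoint of \<open>a\<close> and \<open>b\<close> lies in
    \<open>K\<close>, so its squared distance to \<open>x\<close> is at least
    \<open>d\<close>.\<close>
  have par: "(norm (a - b))\<^sup>2 \<le> 2 * (f a - d) + 2 * (f b - d)" if ab: "a \<in> K" "b \<in> K" for a b
  proof -
    have "(norm (a - b))\<^sup>2 + 4 * f ((1/2) *\<^sub>R (a + b)) = 2 * f a + 2 * f b"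
    proof -
      have h: "x - (1/2) *\<^sub>R (a + b) = (1/2) *\<^sub>R ((x - a) + (x - b))"
      proof -
        have "(1/2) *\<^sub>R ((x - a) + (x - b)) = (1/2) *\<^sub>R (2 *\<^sub>R x) - (1/2) *\<^sub>R (a + b)"
          unfolding scaleR_right_diff_distrib[symmetric] by (simp add: scaleR_2)
        then show ?thesis by simp
      qed
      have "4 * f ((1/2) *\<^sub>R (a + b)) = (norm ((x - a) + (x - b)))\<^sup>2"
        unfolding f_def h by (simp add: power_mult_distrib power_divide)
      moreover have "(norm (a - b))\<^sup>2 = (norm ((x - b) + - (x - a)))\<^sup>2"
        by (simp add: algebra_simps)
      ultimately show ?thesis
        unfolding norm_sum_squared f_def norm_minus_cancel cinner.minus_right uminus_complex.sel
        using Re_cinner_commute[of "x - b" "x - a"] by linarith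
    qed
    moreover have "d \<le> f ((1/2) *\<^sub>R (a + b))"
      by (intro d_le csubspace_scaleR complex_hilbert.subspace_add K ab)
    ultimately show ?thesis by simp
  qed
  have "Cauchy p"
  proof (rule CauchyI)
    fix e :: real assume e: "e > 0"
    then obtain N where N: "inverse (real (Suc N)) < e\<^sup>2 / 4"
      using reals_Archimedean[of "e\<^sup>2 / 4"] by auto
    have "norm (p m - p n) < e" if "m \<ge> N" "n \<ge> N" for m n
    proof -
      have lt: "f (p k) < d + e\<^sup>2 / 4" if "k \<ge> N" for k
      proof -
        have "f (p k) < d + inverse (real (Suc k))" by (rule p(2))
        also have "\<dots> \<le> d + inverse (real (Suc N))"
          using that by (intro add_left_mono le_imp_inverse_le) auto
        also have "\<dots> < d + e\<^sup>2 / 4" using N by (rule add_strict_left_mono)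
        finally show ?thesis .
      qed
      have "(norm (p m - p n))\<^sup>2 \<le> 2 * (f (p m) - d) + 2 * (f (p n) - d)"
        by (rule par) (rule p)+
      also have "\<dots> < e\<^sup>2"
        using lt[OF that(1)] lt[OF that(2)] by (simp add: field_simps)
      finally show ?thesis using e by (simp add: power_less_imp_less_base)
    qed
    then show "\<exists>M. \<forall>m\<ge>M. \<forall>n\<ge>M. norm (p m - p n) < e" by blast
  qed
  then obtain q where q: "p \<longlonglongrightarrow> q"
    by (auto simp: Cauchy_convergent_iff convergent_def)
  have qK: "q \<in> K" using closed_sequentially[OF K(2)] p(1) q by blast
  have fq: "f q \<le> d"
  proof (rule LIMSEQ_le)
    show "(\<lambda>n. f (p n)) \<longlonglongrightarrow> f q"
      unfolding f_def by (intro tendsto_intros q)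
    show "(\<lambda>n. d + inverse (real (Suc n))) \<longlonglongrightarrow> d"
      using tendsto_add[OF tendsto_const LIMSEQ_inverse_real_of_nat, of d] by simp
    show "\<exists>N. \<forall>n\<ge>N. f (p n) \<le> d + inverse (real (Suc n))"
      using p(2) less_imp_le by blast
  qed
  have "cinner (x - q) k = 0" if k: "k \<in> K" for k
  proof (cases "k = 0")
    case False
    \<comment> \<open>\<open>c *\<^sub>C k\<close> is the projection of the residual onto the line
      through \<open>k\<close>. Adding it to \<open>q\<close> lowers the squared distance by the
      square of \<open>cmod (cinner (x - q) k) / norm k\<close>, which minimality forces to be
      zero.\<close>
    define c where "c = cinner (x - q) k / complex_of_real ((norm k)\<^sup>2)"
    have "cinner (x - q) (c *\<^sub>C k) = complex_of_real ((cmod (cinner (x - q) k))\<^sup>2 / (norm k)\<^sup>2)"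
      by (simp add: c_def cinner_scaleC_right complex_norm_square mult.commute del: of_real_power)
    then have 1: "Re (cinner (x - q) (c *\<^sub>C k)) = (cmod (cinner (x - q) k) / norm k)\<^sup>2"
      by (simp only: Re_complex_of_real power_divide)
    have 2: "norm (c *\<^sub>C k) = cmod (cinner (x - q) k) / norm k"
      using False by (simp add: norm_scaleC c_def norm_divide norm_mult power2_eq_square)
    have "f q \<le> f (q + c *\<^sub>C k)"
      using fq d_le[of "q + c *\<^sub>C k"] k qK K(1)
      by (meson complex_hilbert.subspace_add complex_hilbert.subspace_scale order_trans)
    also have "\<dots> = (norm ((x - q) + - (c *\<^sub>C k)))\<^sup>2"
      by (simp add: f_def algebra_simps)
    also have "\<dots> = f q - (cmod (cinner (x - q) k) / norm k)\<^sup>2"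
      unfolding norm_sum_squared norm_minus_cancel cinner.minus_right uminus_complex.sel 1 2
      by (simp add: f_def)
    finally show ?thesis using False by simp
  qed (simp add: cinner.zero_right)
  with qK show ?thesis by blast
qed

text \<open>An element of \<open>K\<close> is determined by its scalar products with
  \<open>K\<close>, which makes the nearest point map linear. As a bounded operator it serves to
  compress other operators to \<open>K\<close>.\<close>

lemma orthogonal_projection:
  fixes K :: "'a::complex_hilbert set"
  assumes K: "csubspace K" "closed K"
  obtains P :: "'a \<Rightarrow>\<^sub>L 'a" where "\<And>x. P x \<in> K" "\<And>x k. k \<in> K \<Longrightarrow> cinner (P x) k = cinner x k"
    "\<And>x. norm (P x) \<le> norm x"
proof -
  obtain p where p: "\<And>x. p x \<in> K" "\<And>x k. k \<in> K \<Longrightarrow> cinner (x - p x) k = 0"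
    using ex_orthogonal_projection[OF K] by metis
  have p2: "cinner (p x) k = cinner x k" if "k \<in> K" for x k
    using p(2)[OF that, of x] by (simp add: cinner.diff_left)
  have uniq: "a = b" if "a \<in> K" "b \<in> K" "\<And>k. k \<in> K \<Longrightarrow> cinner a k = cinner b k" for a b
  proof -
    have "a - b \<in> K" by (rule complex_hilbert.subspace_diff[OF K(1) that(1,2)])
    from that(3)[OF this] have "cinner (a - b) (a - b) = 0" by (simp add: cinner.diff_left)
    then show ?thesis by (simp add: cinner_self)
  qed
  have le: "norm (p x) \<le> norm x" for x
  proof (cases "p x = 0")
    case False
    have "cmod (cinner (p x) (p x)) \<le> norm x * norm (p x)"
      using norm_cinner_le[of x "p x"] by (simp add: p2 p(1))
    with False show ?thesis by (simp add: cinner_self norm_mult power2_eq_square)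
  qed simp
  have "bounded_linear p"
  proof (rule bounded_linear_intro[where K = 1])
    show "p (x + y) = p x + p y" for x y
      by (rule uniq) (simp_all add: p p2 cinner.add_left complex_hilbert.subspace_add[OF K(1)])
    show "p (r *\<^sub>R x) = r *\<^sub>R p x" for r x
      by (rule uniq) (simp_all add: p p2 cinner.scaleR_left csubspace_scaleR[OF K(1)])
  qed (simp add: le)
  then show ?thesis
    using p(1) p2 le by (intro that[of "Blinfun p"]) (simp_all add: bounded_linear_Blinfun_apply)
qed

subsection \<open>Positive definite bounded forms\<close>

text \<open>The type of bounded operators records only real linearity; symmetry supplies complex
  homogeneity.\<close>

lemma symmetric_scaleC:
  fixes f :: "'a::complex_hilbert \<Rightarrow> 'a"
  assumes "\<And>x y. cinner (f x) y = cinner x (f y)"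
  shows "f (c *\<^sub>C x) = c *\<^sub>C f x"
  by (rule cinner_ext) (simp add: assms cinner_scaleC_left)

text \<open>Expanding the square bounds the squared norm of \<open>x - t *\<^sub>R B x\<close> by
  \<open>1 - 2 * t * m + t\<^sup>2 * M\<^sup>2\<close> times that of \<open>x\<close>, and
  \<open>t = m / M\<^sup>2\<close> minimises this factor. The contraction drives the fixed point
  arguments for equations with \<open>B\<close> and for its square root.\<close>

lemma positive_form_contraction:
  fixes B :: "'a::complex_hilbert \<Rightarrow>\<^sub>L 'a"
  assumes m: "m > 0" and pos: "\<And>x. Re (cinner (B x) x) \<ge> m * (norm x)\<^sup>2"
  obtains t q where "t > 0" "0 \<le> q" "q < 1" "\<And>x. norm (x - t *\<^sub>R B x) \<le> q * norm x"
proof -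
  \<comment> \<open>The summand \<open>m\<close> ensures \<open>M > 0\<close> and
    \<open>m \<le> M\<close>, so the radicand in \<open>q\<close> is nonnegative.\<close>
  define M where "M = norm B + m"
  define t where "t = m / M\<^sup>2"
  define q where "q = sqrt (1 - (m / M)\<^sup>2)"
  have M: "M > 0" "m \<le> M" using m by (auto simp: M_def add_nonneg_pos)
  have mM: "0 < m / M" "m / M \<le> 1" using m M by auto
  have sq: "(m / M)\<^sup>2 \<le> 1" "0 < (m / M)\<^sup>2" using mM by (auto simp: power_le_one)
  have "norm (x - t *\<^sub>R B x) \<le> q * norm x" for x
  proof -
    have "norm (B x) \<le> M * norm x"
      using norm_blinfun[of B x] m mult_right_mono[of "norm B" M "norm x"] by (simp add: M_def)
    then have Bx: "(norm (B x))\<^sup>2 \<le> M\<^sup>2 * (norm x)\<^sup>2"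
      using power_mono[of "norm (B x)" "M * norm x" 2] by (simp add: power_mult_distrib)
    have "(norm (x + - (t *\<^sub>R B x)))\<^sup>2 = (norm x)\<^sup>2 - 2 * t * Re (cinner (B x) x) + t\<^sup>2 * (norm (B x))\<^sup>2"
      unfolding norm_sum_squared norm_minus_cancel
      by (simp add: cinner.minus_right cinner.scaleR_right power_mult_distrib Re_cinner_commute[of x "B x"])
    also have "\<dots> \<le> (norm x)\<^sup>2 - 2 * t * (m * (norm x)\<^sup>2) + t\<^sup>2 * (M\<^sup>2 * (norm x)\<^sup>2)"
      using m M pos[of x] Bx by (intro add_mono diff_mono mult_left_mono) (auto simp: t_def)
    also have "\<dots> = (1 - (m / M)\<^sup>2) * (norm x)\<^sup>2"
      using M by (simp add: t_def field_simps power2_eq_square)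
    also have "\<dots> = (q * norm x)\<^sup>2"
      using sq by (simp add: q_def power_mult_distrib)
    finally have "norm (x + - (t *\<^sub>R B x)) \<le> q * norm x"
      by (rule power2_le_imp_le) (use sq in \<open>simp add: q_def\<close>)
    then show ?thesis by (simp only: add_uminus_conv_diff)
  qed
  moreover have "t > 0" "0 \<le> q" "q < 1"
    using m M sq by (auto simp: t_def q_def)
  ultimately show ?thesis by (rule that[rotated -1])
qed

text \<open>A Lax-Milgram argument on \<open>K\<close>: the map
  \<open>b \<mapsto> P (b - t *\<^sub>R B b + t *\<^sub>R h)\<close> is a contraction, and testing
  its fixed point against \<open>k\<close> in \<open>K\<close> leaves the required equation.\<close>

lemma positive_form_riesz:
  fixes B :: "'a::complex_hilbert \<Rightarrow>\<^sub>L 'a"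
  assumes m: "m > 0" and pos: "\<And>x. Re (cinner (B x) x) \<ge> m * (norm x)\<^sup>2"
    and K: "csubspace K" "closed K"
  shows "\<exists>b\<in>K. \<forall>k\<in>K. cinner (B b) k = cinner h k"
proof -
  obtain P :: "'a \<Rightarrow>\<^sub>L 'a" where P: "\<And>x. P x \<in> K" "\<And>x k. k \<in> K \<Longrightarrow> cinner (P x) k = cinner x k"
      "\<And>x. norm (P x) \<le> norm x"
    using orthogonal_projection[OF K] by blast
  obtain t q where t: "t > 0" and q: "0 \<le> q" "q < 1" "\<And>x. norm (x - t *\<^sub>R B x) \<le> q * norm x"
    using positive_form_contraction[OF m pos] by blast
  define F where "F b = P (b - t *\<^sub>R B b + t *\<^sub>R h)" for b
  have "\<exists>!b. b \<in> K \<and> F b = b"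
  proof (rule Banach_fix[OF _ _ q(1,2)])
    show "complete K" using K(2) by (simp add: complete_eq_closed)
    show "K \<noteq> {}" using P(1) by blast
    show "F ` K \<subseteq> K" using P(1) by (auto simp: F_def)
    fix x y
    have "F x - F y = P ((x - y) - t *\<^sub>R B (x - y))"
      unfolding F_def blinfun.diff_right[symmetric]
      by (simp add: blinfun.diff_right scaleR_diff_right algebra_simps)
    then show "dist (F x) (F y) \<le> q * dist x y"
      using P(3) q(3) order_trans unfolding dist_norm by metis
  qed
  then obtain b where b: "b \<in> K" "F b = b" by blast
  have "cinner (B b) k = cinner h k" if k: "k \<in> K" for k
  proof -
    have "cinner b k = cinner (F b) k" by (simp add: b)
    also have "\<dots> = cinner b k - t *\<^sub>R cinner (B b) k + t *\<^sub>R cinner h k"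
      unfolding F_def P(2)[OF k] by (simp add: cinner.add_left cinner.diff_left cinner.scaleR_left)
    finally have "t *\<^sub>R cinner (B b) k = t *\<^sub>R cinner h k" by (simp add: algebra_simps)
    with t show ?thesis by simp
  qed
  with b(1) show ?thesis by blast
qed

text \<open>\<open>R = 1 - Y\<close> is the square root of \<open>t\<close> times the compression of \<open>B\<close> to \<open>K\<close> if
  \<open>Y = (N + Y\<^sup>2) / 2\<close>, where \<open>N\<close> is the compression of \<open>1 - t B\<close>. Scaling by \<open>t\<close> makes
  \<open>N\<close> a strict contraction, so Banach's fixed point theorem gives \<open>Y\<close>.\<close>

lemma positive_form_sqrt:
  fixes B :: "'a::complex_hilbert \<Rightarrow>\<^sub>L 'a"
  assumes sym: "\<And>x y. cinner (B x) y = cinner x (B y)"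
    and K: "csubspace K" "closed K"
    and q: "0 \<le> q" "q < 1" "\<And>x. norm (x - t *\<^sub>R B x) \<le> q * norm x"
  obtains R :: "'a \<Rightarrow>\<^sub>L 'a" where "\<And>c x. R (c *\<^sub>C x) = c *\<^sub>C R x" "bij_betw R K K"
    "\<And>x y. x \<in> K \<Longrightarrow> y \<in> K \<Longrightarrow> cinner (R x) (R y) = t *\<^sub>R cinner (B x) y"
proof -
  obtain P :: "'a \<Rightarrow>\<^sub>L 'a" where P: "\<And>x. P x \<in> K" "\<And>x k. k \<in> K \<Longrightarrow> cinner (P x) k = cinner x k"
      "\<And>x. norm (P x) \<le> norm x"
    using orthogonal_projection[OF K] by blast
  have P_sym: "cinner (P x) y = cinner x (P y)" for x y
    using P(1) P(2)[of "P y" x] P(2)[of "P x" y] by (metis cinner_commute)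
  have P_id: "P x = x" if "x \<in> K" for x
    by (rule cinner_ext) (use P_sym P(2)[OF that] in \<open>metis cinner_commute\<close>)
  \<comment> \<open>Compressing on both sides makes \<open>N\<close> symmetric on the whole space
    while it maps into \<open>K\<close>.\<close>
  define N where "N = P o\<^sub>L (id_blinfun - t *\<^sub>R B) o\<^sub>L P"
  have N: "N x = P (P x - t *\<^sub>R B (P x))" for x
    by (simp add: N_def blinfun.diff_left blinfun.scaleR_left)
  have N_sym: "cinner (N x) y = cinner x (N y)" for x y
  proof -
    have "cinner (N x) y = cinner (P x - t *\<^sub>R B (P x)) (P y)" by (simp only: N P_sym)
    also have "\<dots> = cinner (P x) (P y - t *\<^sub>R B (P y))"
      by (simp add: cinner.diff_left cinner.diff_right cinner.scaleR_left cinner.scaleR_right sym)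
    also have "\<dots> = cinner x (N y)" by (simp only: N P_sym)
    finally show ?thesis .
  qed
  have N_norm: "norm N \<le> q"
  proof (rule norm_blinfun_bound[OF q(1)])
    fix x
    have "norm (N x) \<le> q * norm (P x)" unfolding N using P(3) q(3) order_trans by blast
    also have "\<dots> \<le> q * norm x" by (intro mult_left_mono P(3) q(1))
    finally show "norm (N x) \<le> q * norm x" .
  qed
  \<comment> \<open>These closed conditions are preserved by the iteration, so the fixed point
    inherits symmetry and invariance of \<open>K\<close>. The radius \<open>q\<close> is also what
    makes the iteration a contraction.\<close>
  define S where "S = {Y :: 'a \<Rightarrow>\<^sub>L 'a. norm Y \<le> q \<and> (\<forall>x y. cinner (blinfun_apply Y x) y = cinner x (blinfun_apply Y y)) \<and>
    (\<forall>x\<in>K. blinfun_apply Y x \<in> K)}"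
  define F where "F Y = (1/2) *\<^sub>R (N + (Y o\<^sub>L Y))" for Y :: "'a \<Rightarrow>\<^sub>L 'a"
  have F: "F Y x = (1/2) *\<^sub>R (N x + Y (Y x))" for Y x
    by (simp add: F_def blinfun.add_left blinfun.scaleR_left)
  have "\<exists>!Y. Y \<in> S \<and> F Y = Y"
  proof (rule Banach_fix[OF _ _ q(1,2)])
    have "closed S"
      unfolding closed_sequential_limits
    proof (intro allI impI, elim conjE)
      fix X Y assume X: "\<forall>n. X n \<in> S" "X \<longlonglongrightarrow> Y"
      have Xx: "(\<lambda>n. X n x) \<longlonglongrightarrow> Y x" for x by (intro tendsto_intros X(2))
      have "norm Y \<le> q"
        using X by (intro LIMSEQ_le_const2[OF tendsto_norm[OF X(2)]]) (auto simp: S_def)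
      moreover have "cinner (Y x) y = cinner x (Y y)" for x y
      proof (rule LIMSEQ_unique)
        show "(\<lambda>n. cinner (X n x) y) \<longlonglongrightarrow> cinner (Y x) y"
          by (intro cinner.tendsto Xx tendsto_const)
        have "(\<lambda>n. cinner x (X n y)) \<longlonglongrightarrow> cinner x (Y y)"
          by (intro cinner.tendsto Xx tendsto_const)
        then show "(\<lambda>n. cinner (X n x) y) \<longlonglongrightarrow> cinner x (Y y)"
          using X(1) by (simp add: S_def)
      qed
      moreover have "Y x \<in> K" if "x \<in> K" for x
        using X(1) that by (intro closed_sequentially[OF K(2) _ Xx]) (auto simp: S_def)
      ultimately show "Y \<in> S" by (simp add: S_def)
    qed
    then show "complete S" by (simp add: complete_eq_closed)
    have "0 \<in> S"
      using q(1) complex_hilbert.subspace_0[OF K(1)]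
      by (simp add: S_def cinner.zero_left cinner.zero_right)
    then show "S \<noteq> {}" by blast
    have comp: "norm (Y o\<^sub>L Z) \<le> q * norm Z" if "norm Y \<le> q" for Y Z :: "'a \<Rightarrow>\<^sub>L 'a"
      using norm_blinfun_compose[of Y Z] mult_right_mono[OF that, of "norm Z"] by simp
    have "F Y \<in> S" if "Y \<in> S" for Y
    proof -
      have Y: "norm Y \<le> q" using that by (simp add: S_def)
      have "norm (Y o\<^sub>L Y) \<le> q"
        using comp[OF Y, of Y] mult_mono[OF less_imp_le[OF q(2)] Y] q(1) by simp
      then have "norm (F Y) \<le> q"
        using N_norm norm_triangle_ineq[of N "Y o\<^sub>L Y"] by (simp add: F_def)
      moreover have "F Y x \<in> K" if "x \<in> K" for x
        unfolding F using \<open>Y \<in> S\<close> that P(1)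
        by (intro csubspace_scaleR complex_hilbert.subspace_add K) (auto simp: S_def N)
      ultimately show ?thesis
        using that by (auto simp: S_def F cinner.scaleR_left cinner.scaleR_right cinner.add_left
            cinner.add_right N_sym)
    qed
    then show "F ` S \<subseteq> S" by blast
    fix Y Z assume YZ: "Y \<in> S" "Z \<in> S"
    \<comment> \<open>Splitting \<open>Y\<^sup>2 - Z\<^sup>2\<close> as
      \<open>Y (Y - Z) + (Y - Z) Z\<close> respects the order of the factors; each summand has norm
      at most \<open>q * norm (Y - Z)\<close>.\<close>
    have "F Y - F Z = (1/2) *\<^sub>R ((Y o\<^sub>L (Y - Z)) + ((Y - Z) o\<^sub>L Z))"
      by (rule blinfun_eqI)
        (simp add: F blinfun.diff_left blinfun.diff_right blinfun.add_left blinfun.scaleR_left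
          algebra_simps)
    moreover have "norm (Y o\<^sub>L (Y - Z)) \<le> q * norm (Y - Z)"
      using YZ by (intro comp) (simp add: S_def)
    moreover have "norm ((Y - Z) o\<^sub>L Z) \<le> q * norm (Y - Z)"
      using norm_blinfun_compose[of "Y - Z" Z] mult_left_mono[of "norm Z" q "norm (Y - Z)"] YZ
      by (simp add: S_def mult.commute)
    ultimately show "dist (F Y) (F Z) \<le> q * dist Y Z"
      using norm_triangle_ineq[of "Y o\<^sub>L (Y - Z)" "(Y - Z) o\<^sub>L Z"] by (simp add: dist_norm)
  qed
  then obtain Y where Y: "Y \<in> S" "F Y = Y" by blast
  have Y_norm: "norm Y \<le> q" and Y_sym: "\<And>x y. cinner (Y x) y = cinner x (Y y)"
    and Y_K: "\<And>x. x \<in> K \<Longrightarrow> Y x \<in> K"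
    using Y(1) by (auto simp: S_def)
  have Y_lip: "norm (Y x) \<le> q * norm x" for x
    using norm_blinfun[of Y x] mult_right_mono[OF Y_norm, of "norm x"] by simp
  define R where "R = id_blinfun - Y"
  have R: "R x = x - Y x" for x by (simp add: R_def blinfun.diff_left)
  have "Y (c *\<^sub>C x) = c *\<^sub>C Y x" for c x by (rule symmetric_scaleC) (rule Y_sym)
  then have "R (c *\<^sub>C x) = c *\<^sub>C R x" for c x
    by (simp add: R complex_hilbert.scale_right_diff_distrib)
  moreover have "bij_betw R K K"
  proof -
    \<comment> \<open>Solving \<open>R x = y\<close> inside \<open>K\<close> is again a fixed point
      problem, contractive because \<open>norm Y \<le> q < 1\<close>.\<close>
    have "\<exists>!x. x \<in> K \<and> y + Y x = x" if y: "y \<in> K" for y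
    proof (rule Banach_fix[OF _ _ q(1,2)])
      show "complete K" using K(2) by (simp add: complete_eq_closed)
      show "K \<noteq> {}" using y by blast
      show "(\<lambda>x. y + Y x) ` K \<subseteq> K"
        using y Y_K complex_hilbert.subspace_add[OF K(1)] by blast
      show "dist (y + Y a) (y + Y b) \<le> q * dist a b" for a b
        using Y_lip[of "a - b"] by (simp add: dist_norm blinfun.diff_right)
    qed
    then have "\<exists>!x. x \<in> K \<and> R x = y" if "y \<in> K" for y
      using that unfolding R diff_eq_eq by (metis (no_types, lifting))
    moreover have "R x \<in> K" if "x \<in> K" for x
      unfolding R using that Y_K complex_hilbert.subspace_diff[OF K(1)] by blast
    ultimately show ?thesis
      unfolding bij_betw_def inj_on_def by (metis (no_types, lifting) image_iff subsetI subset_antisym)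
  qed
  moreover have "cinner (R x) (R y) = t *\<^sub>R cinner (B x) y" if xy: "x \<in> K" "y \<in> K" for x y
  proof -
    \<comment> \<open>The equation \<open>2 Y = N + Y\<^sup>2\<close> says that
      \<open>(1 - Y)\<^sup>2 = 1 - N\<close>, and on \<open>K\<close> the right-hand side is
      \<open>t\<close> times the compression of \<open>B\<close>.\<close>
    have "2 *\<^sub>R Y y = 2 *\<^sub>R F Y y" by (simp add: Y)
    then have "2 *\<^sub>R Y y = N y + Y (Y y)" by (simp add: F)
    then have "R (R y) = y - N y"
      by (simp add: R blinfun.diff_right scaleR_2 algebra_simps)
    have "cinner (R x) (R y) = cinner x (R (R y))"
      by (simp add: R cinner.diff_left cinner.diff_right Y_sym blinfun.diff_right)
    also have "R (R y) = y - N y" by fact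
    also have "cinner x (y - N y) = t *\<^sub>R cinner (B x) y"
      using xy
      by (simp add: N P_id P_sym[symmetric] cinner.diff_right cinner.scaleR_right sym)
    finally show ?thesis .
  qed
  ultimately show ?thesis by (rule that)
qed

text \<open>Conjugation with the square roots \<open>R\<close> on \<open>K\<close> and
  \<open>Q\<close> on \<open>L\<close> exchanges the two kinds of isometry: \<open>J\<close> is the
  inverse of \<open>Q\<close> after \<open>U\<close> after \<open>R\<close>, and \<open>U\<close> is
  \<open>Q\<close> after \<open>J\<close> after the inverse of \<open>R\<close>. Both roots carry
  the same factor \<open>t\<close>, which cancels.\<close>

lemma isomorphic_subspaces_form_iff:
  fixes B :: "'a::complex_hilbert \<Rightarrow>\<^sub>L 'a"
  assumes m: "m > 0" and pos: "\<And>x. Re (cinner (B x) x) \<ge> m * (norm x)\<^sup>2"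
    and sym: "\<And>x y. cinner (B x) y = cinner x (B y)"
    and K: "csubspace K" "closed K" and L: "csubspace L" "closed L"
  shows "isomorphic_subspaces K L \<longleftrightarrow> (\<exists>J :: 'a \<Rightarrow> 'a.
    (\<forall>x\<in>K. \<forall>y\<in>K. J (x + y) = J x + J y) \<and>
    (\<forall>c. \<forall>x\<in>K. J (c *\<^sub>C x) = c *\<^sub>C J x) \<and>
    (\<forall>x\<in>K. \<forall>y\<in>K. cinner (B (J x)) (J y) = cinner (B x) y) \<and>
    J ` K = L)" (is "_ \<longleftrightarrow> ?R")
proof -
  obtain t q where t: "t > 0" and q: "0 \<le> q" "q < 1" "\<And>x. norm (x - t *\<^sub>R B x) \<le> q * norm x"
    using positive_form_contraction[OF m pos] by blast
  obtain R :: "'a \<Rightarrow>\<^sub>L 'a" where R: "\<And>c x. R (c *\<^sub>C x) = c *\<^sub>C R x" "bij_betw R K K"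
      "\<And>x y. x \<in> K \<Longrightarrow> y \<in> K \<Longrightarrow> cinner (R x) (R y) = t *\<^sub>R cinner (B x) y"
    using positive_form_sqrt[OF sym K q] by blast
  obtain Q :: "'a \<Rightarrow>\<^sub>L 'a" where Q: "\<And>c x. Q (c *\<^sub>C x) = c *\<^sub>C Q x" "bij_betw Q L L"
      "\<And>x y. x \<in> L \<Longrightarrow> y \<in> L \<Longrightarrow> cinner (Q x) (Q y) = t *\<^sub>R cinner (B x) y"
    using positive_form_sqrt[OF sym L q] by blast
  have inv_add: "inv_into M A (x + y) = inv_into M A x + inv_into M A y"
    if M: "csubspace M" and A: "\<And>c x. A (c *\<^sub>C x) = c *\<^sub>C A x" "bij_betw A M M"
      and xy: "x \<in> M" "y \<in> M" for M x y and A :: "'a \<Rightarrow>\<^sub>L 'a"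
  proof -
    have "inv_into M A z \<in> M" "A (inv_into M A z) = z" if "z \<in> M" for z
      using A(2) that by (auto simp: bij_betw_def intro: inv_into_into f_inv_into_f)
    with xy A show ?thesis
      by (intro inv_into_f_eq complex_hilbert.subspace_add M) (auto simp: blinfun.add_right bij_betw_def)
  qed
  have inv_scale: "inv_into M A (c *\<^sub>C x) = c *\<^sub>C inv_into M A x"
    if M: "csubspace M" and A: "\<And>c x. A (c *\<^sub>C x) = c *\<^sub>C A x" "bij_betw A M M"
      and xy: "x \<in> M" for M c x and A :: "'a \<Rightarrow>\<^sub>L 'a"
  proof -
    have "inv_into M A z \<in> M" "A (inv_into M A z) = z" if "z \<in> M" for z
      using A(2) that by (auto simp: bij_betw_def intro: inv_into_into f_inv_into_f)
    with xy A show ?thesis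
      by (intro inv_into_f_eq complex_hilbert.subspace_scale M) (auto simp: bij_betw_def)
  qed
  have inv_bij: "bij_betw (inv_into M A) M M" if "bij_betw A M M" for M and A :: "'a \<Rightarrow> 'a"
    using that by (rule bij_betw_inv_into)
  show ?thesis
  proof
    assume "isomorphic_subspaces K L"
    then obtain U where U: "\<forall>x\<in>K. \<forall>y\<in>K. U (x + y) = U x + U y"
        "\<forall>c. \<forall>x\<in>K. U (c *\<^sub>C x) = c *\<^sub>C U x" "\<forall>x\<in>K. norm (U x) = norm x" "U ` K = L"
      unfolding isomorphic_subspaces_def by auto
    have RK: "R x \<in> K" if "x \<in> K" for x using R(2) that by (auto simp: bij_betw_def)
    have UL: "U x \<in> L" if "x \<in> K" for x using U(4) that by auto
    have i: "inv_into L Q z \<in> L" "Q (inv_into L Q z) = z" if "z \<in> L" for z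
      using Q(2) that by (auto simp: bij_betw_def intro: inv_into_into f_inv_into_f)
    have J: "cinner (B (inv_into L Q (U (R x)))) (inv_into L Q (U (R y))) = cinner (B x) y"
      if "x \<in> K" "y \<in> K" for x y
    proof -
      have "t *\<^sub>R cinner (B (inv_into L Q (U (R x)))) (inv_into L Q (U (R y))) = cinner (U (R x)) (U (R y))"
        using that by (simp add: Q(3)[symmetric] i RK UL)
      also have "\<dots> = cinner (R x) (R y)"
        by (rule linear_isometry_cinner[OF K(1)]) (use U that RK in auto)
      also have "\<dots> = t *\<^sub>R cinner (B x) y" by (rule R(3)) fact+
      finally show ?thesis using t by simp
    qed
    have "(\<lambda>x. inv_into L Q (U (R x))) ` K = inv_into L Q ` U ` R ` K"
      by (simp add: image_image)
    also have "\<dots> = L" using R(2) U(4) inv_bij[OF Q(2)] by (simp add: bij_betw_def)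
    finally show ?R
      using J
      by (intro exI[of _ "\<lambda>x. inv_into L Q (U (R x))"])
        (simp add: U R RK UL blinfun.add_right inv_add[OF L(1) Q(1,2)] inv_scale[OF L(1) Q(1,2)])
  next
    assume ?R
    then obtain J where J: "\<forall>x\<in>K. \<forall>y\<in>K. J (x + y) = J x + J y"
        "\<forall>c. \<forall>x\<in>K. J (c *\<^sub>C x) = c *\<^sub>C J x"
        "\<forall>x\<in>K. \<forall>y\<in>K. cinner (B (J x)) (J y) = cinner (B x) y" "J ` K = L"
      by auto
    have i: "inv_into K R z \<in> K" "R (inv_into K R z) = z" if "z \<in> K" for z
      using R(2) that by (auto simp: bij_betw_def intro: inv_into_into f_inv_into_f)
    have JL: "J x \<in> L" if "x \<in> K" for x using J(4) that by auto
    have n: "norm (Q (J (inv_into K R x))) = norm x" if "x \<in> K" for x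
    proof -
      have "cinner (Q (J (inv_into K R x))) (Q (J (inv_into K R x))) =
          cinner (R (inv_into K R x)) (R (inv_into K R x))"
        using that by (simp only: Q(3) R(3) J(3)[rule_format] JL i(1))
      then have "(norm (Q (J (inv_into K R x))))\<^sup>2 = (norm x)\<^sup>2"
        using that unfolding cinner_self of_real_eq_iff by (simp only: i)
      then show ?thesis by simp
    qed
    have "(\<lambda>x. Q (J (inv_into K R x))) ` K = Q ` J ` inv_into K R ` K"
      by (simp add: image_image)
    also have "\<dots> = L" using Q(2) J(4) inv_bij[OF R(2)] by (simp add: bij_betw_def)
    finally show "isomorphic_subspaces K L"
      unfolding isomorphic_subspaces_def using n
      by (intro exI[of _ "\<lambda>x. Q (J (inv_into K R x))"])
        (simp add: J Q i blinfun.add_right inv_add[OF K(1) R(1,2)] inv_scale[OF K(1) R(1,2)])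
  qed
qed

declare domIff [iff del]

section \<open>Joint pairs of abstract Friedrichs operators\<close>

text \<open>\<open>B\<close> is the bounded extension of \<open>T + S\<close> to the whole space.\<close>

locale friedrichs_pair =
  fixes T S :: "'a::complex_hilbert operator" and B :: "'a \<Rightarrow>\<^sub>L 'a" and m :: real
  assumes linear_T: "linear_operator T" and linear_S: "linear_operator S"
    and dom_S: "dom S = dom T"
    and dense: "closure (dom T) = UNIV"
    and formally_adjoint:
      "\<lbrakk>x \<in> dom T; y \<in> dom T\<rbrakk> \<Longrightarrow> cinner (the (T x)) y = cinner x (the (S y))"
    and sum_eq: "x \<in> dom T \<Longrightarrow> the (T x) + the (S x) = B x"
    and B_sym: "cinner (B x) y = cinner x (B y)"
    and m_pos: "m > 0"
    and B_pos: "Re (cinner (B x) x) \<ge> m * (norm x)\<^sup>2"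

text \<open>The sum \<open>f\<close> is Lipschitz on a dense domain and so extends continuously to
  the whole space. Linearity, the bound, symmetry and positivity are closed conditions and survive
  the extension.\<close>

lemma joint_abstract_friedrichs_bounded_sum:
  fixes T S :: "'a::complex_hilbert operator"
  assumes "joint_abstract_friedrichs T S"
  shows "\<exists>B m. friedrichs_pair T S B m"
proof -
  have T: "linear_operator T" and S: "linear_operator S" and dom: "dom S = dom T"
    and dense: "closure (dom T) = UNIV"
    and adj: "\<And>x y. x \<in> dom T \<Longrightarrow> y \<in> dom T \<Longrightarrow> cinner (the (T x)) y = cinner x (the (S y))"
    using assms unfolding joint_abstract_friedrichs_def by auto
  define f where "f x = the (T x) + the (S x)" for x
  obtain l where l: "l > 0" "\<And>x. x \<in> dom T \<Longrightarrow> norm (f x) \<le> 2 * l * norm x"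
    using assms unfolding joint_abstract_friedrichs_def f_def by auto
  obtain m where m: "m > 0" "\<And>x. x \<in> dom T \<Longrightarrow> Re (cinner (f x) x) \<ge> 2 * m * (norm x)\<^sup>2"
    using assms unfolding joint_abstract_friedrichs_def f_def by blast
  have sub: "csubspace (dom T)" using T by (simp add: linear_operator_def)
  have f_add: "f (x + y) = f x + f y" if "x \<in> dom T" "y \<in> dom T" for x y
    using T S that unfolding linear_operator_def f_def dom by simp
  have f_scaleR: "f (r *\<^sub>R x) = r *\<^sub>R f x" if "x \<in> dom T" for r x
    using T S that unfolding linear_operator_def f_def dom scaleR_scaleC[where 'a = 'a]
    by (simp add: scaleC_add_right)
  have f_sym: "cinner (f x) y = cinner x (f y)" if "x \<in> dom T" "y \<in> dom T" for x y
  proof -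
    have "cinner (the (S x)) y = cinner x (the (T y))"
      using adj[OF that(2,1)] cinner_commute[of "the (S x)" y] cinner_commute[of x "the (T y)"]
      by simp
    with adj[OF that] show ?thesis
      by (simp add: f_def cinner_add_left cinner_add_right)
  qed
  have "dist (f x) (f y) \<le> 2 * l * dist x y" if "x \<in> dom T" "y \<in> dom T" for x y
  proof -
    have "f x = f (x - y) + f y"
      using f_add[of "x - y" y] that complex_hilbert.subspace_diff[OF sub] by simp
    then show ?thesis
      using l(2)[of "x - y"] that complex_hilbert.subspace_diff[OF sub] by (simp add: dist_norm)
  qed
  then have "(2 * l)-lipschitz_on (dom T) f"
    using l(1) by (auto intro!: lipschitz_onI)
  then have "uniformly_continuous_on (dom T) f" by (rule lipschitz_on_uniformly_continuous)
  then obtain g where "uniformly_continuous_on (closure (dom T)) g"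
      and g: "\<And>x. x \<in> dom T \<Longrightarrow> f x = g x"
    by (rule uniformly_continuous_on_extension_on_closure) blast
  then have "continuous_on UNIV g"
    using dense by (simp add: uniformly_continuous_imp_continuous)
  then have cont: "continuous_on UNIV (\<lambda>x. g (h x))" if "continuous_on UNIV h"
    for h :: "'b::topological_space \<Rightarrow> 'a"
    using that continuous_on_compose2 by blast
  \<comment> \<open>A closed condition that holds on the dense domain holds everywhere;
    \<open>ext2\<close> is the version for pairs, by density of the product of the domain with
    itself.\<close>
  have ext: "P x" if "closed {x. P x}" "\<And>x. x \<in> dom T \<Longrightarrow> P x" for P and x :: 'a
    using closure_minimal[of "dom T" "{x. P x}"] that dense by auto
  have ext2: "P x y" if "closed {p. P (fst p) (snd p)}"
      "\<And>x y. x \<in> dom T \<Longrightarrow> y \<in> dom T \<Longrightarrow> P x y" for P and x y :: 'a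
  proof -
    have "closure (dom T \<times> dom T) \<subseteq> {p. P (fst p) (snd p)}"
      using that by (intro closure_minimal) auto
    then have "(x, y) \<in> {p. P (fst p) (snd p)}"
      using dense unfolding closure_Times by (metis UNIV_I UNIV_Times_UNIV subsetD)
    then show ?thesis by simp
  qed
  note cinner_cont = cinner.continuous_on
  have g_add: "g (x + y) = g x + g y" for x y
    by (rule ext2, intro closed_Collect_eq continuous_intros cont)
      (use f_add complex_hilbert.subspace_add[OF sub] in \<open>auto simp flip: g\<close>)
  have g_scaleR: "g (r *\<^sub>R x) = r *\<^sub>R g x" for r x
    by (rule ext, intro closed_Collect_eq continuous_intros cont)
      (use f_scaleR csubspace_scaleR[OF sub] in \<open>auto simp flip: g\<close>)
  have g_norm: "norm (g x) \<le> norm x * (2 * l)" for x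
    by (rule ext, intro closed_Collect_le continuous_intros cont)
      (use l(2) in \<open>auto simp flip: g simp: mult.commute\<close>)
  have g_sym: "cinner (g x) y = cinner x (g y)" for x y
    by (rule ext2, intro closed_Collect_eq cinner_cont continuous_intros cont)
      (use f_sym in \<open>auto simp flip: g\<close>)
  have g_pos: "Re (cinner (g x) x) \<ge> 2 * m * (norm x)\<^sup>2" for x
    by (rule ext, intro closed_Collect_le cinner_cont continuous_intros cont)
      (use m(2) in \<open>auto simp flip: g\<close>)
  have "bounded_linear g"
    by (rule bounded_linear_intro[OF g_add g_scaleR g_norm])
  then have "friedrichs_pair T S (Blinfun g) (2 * m)"
    by unfold_locales
      (use T S dom dense adj m(1) g_sym g_pos g in
        \<open>auto simp: bounded_linear_Blinfun_apply f_def\<close>)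
  then show ?thesis by blast
qed

text \<open>The equivalence says that \<open>V\<close> is its own orthogonal complement for the
  boundary form. Writing operator values as \<open>Some z\<close> makes membership in the domain of
  the adjoint part of the condition.\<close>

definition self_orthogonal_domain ::
    "'a::complex_hilbert operator \<Rightarrow> 'a operator \<Rightarrow> 'a set \<Rightarrow> bool"
  where "self_orthogonal_domain T S V \<longleftrightarrow> csubspace V \<and> dom T \<subseteq> V \<and>
    (\<forall>v. v \<in> V \<longleftrightarrow> (\<exists>z. adjoint_op T v = Some z \<and>
      (\<forall>u\<in>V. \<forall>w. adjoint_op S u = Some w \<longrightarrow> cinner w v = cinner u z)))"

context friedrichs_pair
begin

text \<open>The setting is symmetric in \<open>T\<close> and \<open>S\<close> with the same
  \<open>B\<close> and \<open>m\<close>, so each fact proved below for one adjoint is also available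
  for the other.\<close>

lemma swap: "friedrichs_pair S T B m"
proof
  show "cinner (the (S x)) y = cinner x (the (T y))" if "x \<in> dom S" "y \<in> dom S" for x y
    using formally_adjoint[of y x] that cinner_commute[of "the (S x)" y]
      cinner_commute[of x "the (T y)"] by (simp add: dom_S)
qed (use linear_T linear_S dom_S dense sum_eq B_sym m_pos B_pos in \<open>auto simp: add.commute\<close>)

section \<open>The two adjoints and their kernels\<close>

lemma adjoint_S_iff:
  "adjoint_op S v = Some w \<longleftrightarrow> (\<forall>u\<in>dom T. cinner (the (S u)) v = cinner u w)"
  using adjoint_op_eq_Some_iff[of S] dense by (simp add: dom_S)

lemma adjoint_T_iff:
  "adjoint_op T v = Some w \<longleftrightarrow> (\<forall>u\<in>dom T. cinner (the (T u)) v = cinner u w)"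
  using adjoint_op_eq_Some_iff[of T] dense by simp

text \<open>Adding the two adjoint relations on \<open>dom T\<close> gives
  \<open>cinner u (B v)\<close>, so each relation determines the other. Thus the two adjoints have
  one domain and sum to \<open>B\<close>; on the kernel of one, the other acts as
  \<open>B\<close>.\<close>

lemma adjoint_T_eq: "adjoint_op T v = Some z \<longleftrightarrow> adjoint_op S v = Some (B v - z)"
proof -
  have "cinner (the (T u)) v = cinner u z \<longleftrightarrow> cinner (the (S u)) v = cinner u (B v - z)"
    if "u \<in> dom T" for u
  proof -
    have "cinner (the (T u)) v + cinner (the (S u)) v = cinner u (B v)"
      by (simp only: sum_eq[OF that] B_sym flip: cinner_add_left)
    then have "cinner (the (S u)) v = cinner u (B v) - cinner (the (T u)) v"
      by (simp add: eq_diff_eq add.commute)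
    then show ?thesis by (simp add: cinner.diff_right)
  qed
  then show ?thesis by (simp add: adjoint_S_iff adjoint_T_iff)
qed

lemma adjoint_S_eq: "adjoint_op S v = Some w \<longleftrightarrow> adjoint_op T v = Some (B v - w)"
  by (simp add: adjoint_T_eq)

lemma dom_adjoint: "dom (adjoint_op T) = dom (adjoint_op S)"
  using adjoint_S_eq adjoint_T_eq by (meson domD domI subsetI subset_antisym)

lemma adjoint_S_add:
  "\<lbrakk>adjoint_op S u = Some w; adjoint_op S v = Some z\<rbrakk> \<Longrightarrow> adjoint_op S (u + v) = Some (w + z)"
  by (simp add: adjoint_S_iff cinner_add_right)

lemma adjoint_S_diff:
  "\<lbrakk>adjoint_op S u = Some w; adjoint_op S v = Some z\<rbrakk> \<Longrightarrow> adjoint_op S (u - v) = Some (w - z)"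
  by (simp add: adjoint_S_iff cinner.diff_right)

lemma adjoint_S_scaleC:
  "adjoint_op S u = Some w \<Longrightarrow> adjoint_op S (c *\<^sub>C u) = Some (c *\<^sub>C w)"
  by (simp add: adjoint_S_iff cinner_scaleC_right)

lemma op_kernel_adjoint_S: "op_kernel (adjoint_op S) = {u. adjoint_op S u = Some 0}"
  by (auto simp: op_kernel_def domIff)

lemma csubspace_kernel: "csubspace (op_kernel (adjoint_op S))"
  unfolding op_kernel_adjoint_S
  by (rule complex_hilbert.subspaceI)
    (use adjoint_S_add[where w = 0 and z = 0] adjoint_S_scaleC[where w = 0] in
      \<open>auto simp: adjoint_S_iff cinner.zero_right\<close>)

lemma closed_kernel: "closed (op_kernel (adjoint_op S))"
proof -
  \<comment> \<open>The kernel of the adjoint is the orthogonal complement of the range of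
    \<open>S\<close>.\<close>
  have "op_kernel (adjoint_op S) = (\<Inter>u\<in>dom T. {v. cinner (the (S u)) v = 0})"
    unfolding op_kernel_adjoint_S by (auto simp: adjoint_S_iff cinner.zero_right)
  then show ?thesis
    by (auto intro!: closed_INT closed_Collect_eq cinner.continuous_on continuous_intros)
qed

text \<open>\<open>B u - w\<close> is the value of \<open>adjoint_op T\<close> at \<open>u\<close>,
  so the second hypothesis says that the boundary form vanishes at the pair \<open>u\<close>,
  \<open>u\<close>. Then twice the real part of \<open>cinner w u\<close> is that of
  \<open>cinner (B u) u\<close>, and Cauchy-Schwarz finishes.\<close>

lemma coercive:
  assumes "adjoint_op S u = Some w" "cinner w u = cinner u (B u - w)"
  shows "m / 2 * norm u \<le> norm w"
proof (cases "u = 0")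
  case False
  have "Re (cinner w u) = Re (cinner (B u) u) - Re (cinner w u)"
    using assms(2) Re_cinner_commute[of w u] by (simp add: cinner.diff_right B_sym)
  with B_pos[of u] have "m / 2 * (norm u)\<^sup>2 \<le> Re (cinner w u)" by linarith
  also have "\<dots> \<le> norm w * norm u"
    using complex_Re_le_cmod norm_cinner_le order_trans by blast
  finally show ?thesis using False by (simp add: power2_eq_square)
qed simp

subsection \<open>The closure of the graph\<close>

abbreviation "G \<equiv> closure (Map.graph T)"

lemma in_graph_iff: "p \<in> Map.graph T \<longleftrightarrow> fst p \<in> dom T \<and> snd p = the (T (fst p))"
  by (cases p) (auto simp: Map.graph_def domIff)

lemma in_graph_closure: "x \<in> dom T \<Longrightarrow> (x, the (T x)) \<in> G"
  using closure_subset[of "Map.graph T"] by (simp add: in_graph_iff subset_iff)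

text \<open>The adjoint relation for \<open>S\<close> is a closed condition on pairs, and formal
  adjointness puts the graph of \<open>T\<close> inside it.\<close>

lemma graph_closureD: "(u, w) \<in> G \<Longrightarrow> adjoint_op S u = Some w"
proof -
  assume "(u, w) \<in> G"
  moreover have "G \<subseteq> (\<Inter>x\<in>dom T. {p. cinner (the (S x)) (fst p) = cinner x (snd p)})"
  proof (rule closure_minimal)
    show "Map.graph T \<subseteq> (\<Inter>x\<in>dom T. {p. cinner (the (S x)) (fst p) = cinner x (snd p)})"
      using friedrichs_pair.formally_adjoint[OF swap] by (auto simp: in_graph_iff dom_S)
  qed (intro closed_INT ballI closed_Collect_eq cinner.continuous_on continuous_intros)
  ultimately show ?thesis by (auto simp: adjoint_S_iff)
qed

text \<open>The boundary form vanishes when one argument lies in the domain of the closure of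
  \<open>T\<close>: the identity holds on the graph by definition of the adjoint and is closed in
  the pair.\<close>

lemma graph_closure_cinner:
  assumes "(u, w) \<in> G" "adjoint_op T v = Some z"
  shows "cinner w v = cinner u z"
proof -
  have "G \<subseteq> {p. cinner (snd p) v = cinner (fst p) z}"
    by (rule closure_minimal)
      (use assms(2) in \<open>auto simp: adjoint_T_iff in_graph_iff
        intro!: closed_Collect_eq cinner.continuous_on continuous_intros\<close>)
  with assms(1) show ?thesis by auto
qed

lemma graph_closure_coercive: "(u, w) \<in> G \<Longrightarrow> m / 2 * norm u \<le> norm w"
  using coercive[OF graph_closureD] graph_closure_cinner graph_closureD adjoint_S_eq by blast

text \<open>The continuous map \<open>(u, w) \<mapsto> (u, B u - w)\<close> carries the graph of
  \<open>T\<close> into that of \<open>S\<close>, hence closure into closure.\<close>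

lemma graph_closure_swap: "(u, w) \<in> G \<Longrightarrow> (u, B u - w) \<in> closure (Map.graph S)"
proof -
  assume u: "(u, w) \<in> G"
  have "the (S x) = B x - the (T x)" if "x \<in> dom T" for x
    using sum_eq[OF that] by (simp add: algebra_simps)
  then have "(\<lambda>p. (fst p, B (fst p) - snd p)) ` Map.graph T \<subseteq> Map.graph S"
    using dom_S friedrichs_pair.in_graph_iff[OF swap] by (auto simp: in_graph_iff)
  then have "(\<lambda>p. (fst p, B (fst p) - snd p)) ` G \<subseteq> closure (Map.graph S)"
    by (intro image_closure_subset continuous_intros) (use closure_subset in blast)+
  with u show ?thesis by force
qed

lemma graph_closure_add: "\<lbrakk>p \<in> G; p' \<in> G\<rbrakk> \<Longrightarrow> p + p' \<in> G"
proof -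
  assume "p \<in> G" "p' \<in> G"
  then obtain x y where x: "\<And>n. x n \<in> Map.graph T" "x \<longlonglongrightarrow> p"
      and y: "\<And>n. y n \<in> Map.graph T" "y \<longlonglongrightarrow> p'"
    unfolding closure_sequential by auto
  have "x n + y n \<in> Map.graph T" for n
    using x(1)[of n] y(1)[of n] linear_T complex_hilbert.subspace_add
    by (auto simp: in_graph_iff linear_operator_def)
  then show ?thesis
    unfolding closure_sequential using tendsto_add[OF x(2) y(2)]
    by (intro exI[of _ "\<lambda>n. x n + y n"]) simp
qed

lemma graph_closure_scaleC: "(u, w) \<in> G \<Longrightarrow> (c *\<^sub>C u, c *\<^sub>C w) \<in> G"
proof -
  assume u: "(u, w) \<in> G"
  have "(\<lambda>p. (c *\<^sub>C fst p, c *\<^sub>C snd p)) ` Map.graph T \<subseteq> Map.graph T"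
    using linear_T complex_hilbert.subspace_scale
    by (auto simp: in_graph_iff linear_operator_def)
  then have "(\<lambda>p. (c *\<^sub>C fst p, c *\<^sub>C snd p)) ` G \<subseteq> G"
    by (intro image_closure_subset continuous_intros
        bounded_linear.continuous_on[OF bounded_linear_scaleC])
      (use closure_subset in blast)+
  with u show ?thesis by force
qed

lemma zero_in_graph_closure: "(0, 0) \<in> G"
proof -
  have "0 \<in> dom T" "the (T 0) = 0"
    using linear_T complex_hilbert.subspace_0 complex_hilbert.scale_zero_left
    unfolding linear_operator_def by metis+
  then show ?thesis using closure_subset by (force simp: in_graph_iff)
qed

lemma graph_closure_diff:
  assumes "(u, w) \<in> G" "(v, z) \<in> G"
  shows "(u - v, w - z) \<in> G"
  using graph_closure_add[OF assms(1) graph_closure_scaleC[OF assms(2), of "- 1"]] by simp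

lemma csubspace_range: "csubspace (snd ` G)"
proof (rule complex_hilbert.subspaceI)
  show "0 \<in> snd ` G" using zero_in_graph_closure by force
  show "x + y \<in> snd ` G" if "x \<in> snd ` G" "y \<in> snd ` G" for x y
  proof -
    from that obtain p p' where "p \<in> G" "p' \<in> G" "x = snd p" "y = snd p'" by blast
    then show ?thesis using graph_closure_add[of p p'] by (metis image_eqI snd_add)
  qed
  show "c *\<^sub>C x \<in> snd ` G" if "x \<in> snd ` G" for c x
    using that graph_closure_scaleC by force
qed

text \<open>The lower bound \<open>m / 2\<close> turns convergent images into Cauchy preimages, and
  the graph closure contains the limit pair.\<close>

lemma closed_range: "closed (snd ` G)"
  unfolding closed_sequential_limits
proof (intro allI impI, elim conjE)
  fix w l assume "\<forall>n. w n \<in> snd ` G" and l: "w \<longlonglongrightarrow> l"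
  then have "\<forall>n. \<exists>u. (u, w n) \<in> G" by fastforce
  then obtain u where u: "\<And>n. (u n, w n) \<in> G" by metis
  have "Cauchy u"
  proof (rule CauchyI)
    fix e :: real assume e: "e > 0"
    have "Cauchy w" using l by (rule LIMSEQ_imp_Cauchy)
    then obtain N where N: "\<And>i j. i \<ge> N \<Longrightarrow> j \<ge> N \<Longrightarrow> norm (w i - w j) < m / 2 * e"
      using CauchyD[of w "m / 2 * e"] e m_pos by auto
    have "norm (u i - u j) < e" if "i \<ge> N" "j \<ge> N" for i j
    proof -
      have "m / 2 * norm (u i - u j) < m / 2 * e"
        using graph_closure_coercive[OF graph_closure_diff[OF u u]] N[OF that] by (rule le_less_trans)
      with m_pos show ?thesis by simp
    qed
    then show "\<exists>M. \<forall>i\<ge>M. \<forall>j\<ge>M. norm (u i - u j) < e" by blast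
  qed
  then obtain v where "u \<longlonglongrightarrow> v" by (auto simp: Cauchy_convergent_iff convergent_def)
  then have "(\<lambda>n. (u n, w n)) \<longlonglongrightarrow> (v, l)" using l by (rule tendsto_Pair)
  then have "(v, l) \<in> G" by (rule closed_sequentially[OF closed_closure u])
  then show "l \<in> snd ` G" by force
qed

text \<open>Choose \<open>b\<close> in the kernel so that \<open>h - B b\<close> is orthogonal to
  the kernel, and let \<open>w\<close> be the projection of \<open>h - B b\<close> onto the range of
  the closure. The residual \<open>r\<close> lies in the kernel, yet it is orthogonal to everything
  it is composed of, so it vanishes.\<close>

lemma decomposition:
  "\<exists>u w b. (u, w) \<in> G \<and> b \<in> op_kernel (adjoint_op T) \<and> h = w + B b"
proof -
  interpret S: friedrichs_pair S T B m by (rule swap)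
  obtain b where b: "b \<in> op_kernel (adjoint_op T)"
      "\<And>k. k \<in> op_kernel (adjoint_op T) \<Longrightarrow> cinner (B b) k = cinner h k"
    using positive_form_riesz[OF m_pos B_pos S.csubspace_kernel S.closed_kernel] by blast
  obtain w where w: "w \<in> snd ` G" "\<And>k. k \<in> snd ` G \<Longrightarrow> cinner (h - B b - w) k = 0"
    using ex_orthogonal_projection[OF csubspace_range closed_range] by blast
  define r where "r = h - B b - w"
  have "cinner (the (T x)) r = cinner x 0" if "x \<in> dom T" for x
  proof -
    have "the (T x) \<in> snd ` G"
      using in_graph_closure[OF that] by force
    from w(2)[OF this] show ?thesis
      using cinner_commute[of "the (T x)" r] by (simp add: r_def cinner.zero_right)
  qed
  then have r: "adjoint_op T r = Some 0" by (simp add: adjoint_T_iff)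
  \<comment> \<open>The range of the closure of \<open>T\<close> is orthogonal to the kernel of
    \<open>adjoint_op T\<close>.\<close>
  then have "cinner w r = 0"
    using w(1) graph_closure_cinner[OF _ r] by (force simp: cinner.zero_right)
  moreover have "cinner (B b) r = cinner h r"
    using r by (intro b) (simp add: S.op_kernel_adjoint_S)
  moreover have "cinner r x = cinner h x - cinner (B b) x - cinner w x" for x
    by (simp add: r_def cinner.diff_left)
  ultimately have "cinner r r = 0" by simp
  then have "h = w + B b" by (simp add: cinner_self r_def algebra_simps)
  with b(1) w(1) show ?thesis by force
qed

lemma dom_closure_op: "dom (closure_op T) = fst ` G"
proof -
  have "fst ` G = {u. \<exists>w. (u, w) \<in> G}" by force
  then show ?thesis by (simp add: closure_op_def dom_def)
qed

lemma dom_subset_closure: "dom T \<subseteq> fst ` G"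
  using in_graph_closure by force

subsection \<open>Domains of mutually adjoint realisations\<close>

text \<open>Passing from one adjoint to the other replaces a value \<open>y\<close> at
  \<open>u\<close> by \<open>B u - y\<close>. The extra terms \<open>cinner (B u) v\<close> and
  \<open>cinner u (B v)\<close> agree by symmetry, so the boundary form only changes sign.\<close>

lemma self_orthogonal_domain_swap:
  assumes "self_orthogonal_domain T S V"
  shows "self_orthogonal_domain S T V"
proof -
  have eq: "(\<exists>z. adjoint_op T v = Some z \<and>
          (\<forall>u\<in>V. \<forall>w. adjoint_op S u = Some w \<longrightarrow> cinner w v = cinner u z)) \<longleftrightarrow>
        (\<exists>w. adjoint_op S v = Some w \<and>
          (\<forall>u\<in>V. \<forall>z. adjoint_op T u = Some z \<longrightarrow> cinner z v = cinner u w))"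
    (is "?L \<longleftrightarrow> ?R") for v
  proof
    assume ?L
    then obtain z where z: "adjoint_op T v = Some z"
        "\<And>u w. u \<in> V \<Longrightarrow> adjoint_op S u = Some w \<Longrightarrow> cinner w v = cinner u z"
      by blast
    have "cinner y v = cinner u (B v - z)" if "u \<in> V" "adjoint_op T u = Some y" for u y
      using z(2)[OF that(1), of "B u - y"] that(2)
      by (simp add: adjoint_T_eq cinner.diff_left cinner.diff_right B_sym algebra_simps)
    then show ?R using z(1) adjoint_T_eq by blast
  next
    assume ?R
    then obtain w where w: "adjoint_op S v = Some w"
        "\<And>u z. u \<in> V \<Longrightarrow> adjoint_op T u = Some z \<Longrightarrow> cinner z v = cinner u w"
      by blast
    have "cinner y v = cinner u (B v - w)" if "u \<in> V" "adjoint_op S u = Some y" for u y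
      using w(2)[OF that(1), of "B u - y"] that(2)
      by (simp add: adjoint_S_eq cinner.diff_left cinner.diff_right B_sym algebra_simps)
    then show ?L using w(1) adjoint_S_eq by blast
  qed
  show ?thesis using assms unfolding self_orthogonal_domain_def dom_S eq .
qed

text \<open>The last two conclusions are the two halves of self-orthogonality: the boundary form
  vanishes on \<open>V\<close>, and \<open>V\<close> contains every vector orthogonal to it.\<close>

lemma self_orthogonal_domainD:
  assumes V: "self_orthogonal_domain T S V"
  shows "csubspace V" "dom T \<subseteq> V" "V \<subseteq> dom (adjoint_op S)"
    "\<lbrakk>u \<in> V; adjoint_op S u = Some w; v \<in> V; adjoint_op T v = Some z\<rbrakk> \<Longrightarrow> cinner w v = cinner u z"
    "\<lbrakk>adjoint_op T v = Some z;
      \<And>u w. u \<in> V \<Longrightarrow> adjoint_op S u = Some w \<Longrightarrow> cinner w v = cinner u z\<rbrakk> \<Longrightarrow> v \<in> V"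
proof -
  show "csubspace V" "dom T \<subseteq> V" using V by (auto simp: self_orthogonal_domain_def)
  show "V \<subseteq> dom (adjoint_op S)"
    using V unfolding self_orthogonal_domain_def dom_adjoint[symmetric] by (blast intro: domI)
  show "cinner w v = cinner u z"
    if "u \<in> V" "adjoint_op S u = Some w" "v \<in> V" "adjoint_op T v = Some z"
    using V that unfolding self_orthogonal_domain_def by (metis option.inject)
  show "v \<in> V" if "adjoint_op T v = Some z"
      "\<And>u w. u \<in> V \<Longrightarrow> adjoint_op S u = Some w \<Longrightarrow> cinner w v = cinner u z"
    using V that unfolding self_orthogonal_domain_def by blast
qed

text \<open>Testing only with \<open>dom T\<close>, which lies in \<open>V\<close>, shows that the
  adjoint of the restriction is a restriction of \<open>adjoint_op T\<close>. Testing with all of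
  \<open>V\<close> then identifies its domain as the orthogonal complement of \<open>V\<close>,
  which is \<open>V\<close>.\<close>

lemma adjoint_restrict:
  assumes V: "self_orthogonal_domain T S V"
  shows "adjoint_op (adjoint_op S |` V) = adjoint_op T |` V"
proof
  fix v
  note VD = self_orthogonal_domainD[OF V]
  have dom: "dom (adjoint_op S |` V) = V" using VD(3) by auto
  have dense_V: "closure (dom (adjoint_op S |` V)) = UNIV"
    unfolding dom using dense closure_mono[OF VD(2)] by auto
  have iff: "adjoint_op (adjoint_op S |` V) v = Some z \<longleftrightarrow>
      (\<forall>u\<in>V. cinner (the (adjoint_op S u)) v = cinner u z)" for z
    unfolding adjoint_op_eq_Some_iff[OF dense_V] dom by simp
  have S: "adjoint_op S u = Some (the (adjoint_op S u))" if "u \<in> V" for u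
    using VD(3) that by (metis domD option.sel subsetD)
  have "adjoint_op (adjoint_op S |` V) v = Some z \<longleftrightarrow> v \<in> V \<and> adjoint_op T v = Some z" for z
  proof
    assume "adjoint_op (adjoint_op S |` V) v = Some z"
    then have orth: "cinner (the (adjoint_op S u)) v = cinner u z" if "u \<in> V" for u
      using that iff by blast
    have "cinner (the (T u)) v = cinner u z" if "u \<in> dom T" for u
    proof -
      have "(u, the (T u)) \<in> G"
        using that by (rule in_graph_closure)
      then have "adjoint_op S u = Some (the (T u))" by (rule graph_closureD)
      with orth[of u] VD(2) that show ?thesis by auto
    qed
    then have T: "adjoint_op T v = Some z" by (simp add: adjoint_T_iff)
    moreover have "v \<in> V" by (rule VD(5)[OF T]) (use orth in force)
    ultimately show "v \<in> V \<and> adjoint_op T v = Some z" by simp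
  next
    assume "v \<in> V \<and> adjoint_op T v = Some z"
    then show "adjoint_op (adjoint_op S |` V) v = Some z"
      using iff VD(4) S by blast
  qed
  then have "adjoint_op (adjoint_op S |` V) v = Some z \<longleftrightarrow> (adjoint_op T |` V) v = Some z" for z
    by (simp add: restrict_map_def)
  then show "adjoint_op (adjoint_op S |` V) v = (adjoint_op T |` V) v"
    by (metis option.exhaust)
qed

text \<open>Injectivity comes from \<open>coercive\<close>, because the boundary form vanishes on
  \<open>V\<close>.\<close>

lemma bijective_from_restrict:
  assumes V: "self_orthogonal_domain T S V"
    and surj: "\<And>h. \<exists>v\<in>V. adjoint_op S v = Some h"
  shows "bijective_from V (adjoint_op S |` V)"
proof -
  note VD = self_orthogonal_domainD[OF V]
  have S: "adjoint_op S u = Some (the (adjoint_op S u))" if "u \<in> V" for u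
    using VD(3) that by (metis domD option.sel subsetD)
  have "inj_on (\<lambda>u. the (adjoint_op S u)) V"
  proof (rule inj_onI)
    fix u v assume uv: "u \<in> V" "v \<in> V" "the (adjoint_op S u) = the (adjoint_op S v)"
    have d: "u - v \<in> V" using uv complex_hilbert.subspace_diff[OF VD(1)] by blast
    have 0: "adjoint_op S (u - v) = Some 0"
      using adjoint_S_diff[OF S[OF uv(1)] S[OF uv(2)]] uv(3) by simp
    have "m / 2 * norm (u - v) \<le> norm (0::'a)"
      using 0 VD(4)[OF d 0 d] adjoint_S_eq by (intro coercive) blast+
    then have "norm (u - v) \<le> 0" using m_pos by (simp add: mult_le_0_iff)
    then show "u = v" by simp
  qed
  moreover have "(\<lambda>u. the (adjoint_op S u)) ` V = UNIV"
  proof -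
    have "h \<in> (\<lambda>u. the (adjoint_op S u)) ` V" for h
      using surj[of h] by force
    then show ?thesis by blast
  qed
  ultimately have "bij_betw (\<lambda>u. the (adjoint_op S u)) V UNIV" by (simp add: bij_betw_def)
  then have "bij_betw (\<lambda>u. the ((adjoint_op S |` V) u)) V UNIV"
    by (subst bij_betw_cong[where g = "\<lambda>u. the (adjoint_op S u)"]) auto
  moreover have "dom (adjoint_op S |` V) = V" using VD(3) by auto
  ultimately show ?thesis by (simp add: bijective_from_def)
qed

section \<open>Closedness of the domain in the graph norm\<close>

lemma linear_adjoint_S: "linear_operator (adjoint_op S)"
  unfolding linear_operator_def
proof (intro conjI ballI allI)
  show "csubspace (dom (adjoint_op S))"
  proof (rule complex_hilbert.subspaceI)
    show "0 \<in> dom (adjoint_op S)"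
      by (rule domI[of _ _ 0]) (simp add: adjoint_S_iff cinner.zero_right)
  qed (meson adjoint_S_add adjoint_S_scaleC domD domI)+
  show "the (adjoint_op S (u + v)) = the (adjoint_op S u) + the (adjoint_op S v)"
    if "u \<in> dom (adjoint_op S)" "v \<in> dom (adjoint_op S)" for u v
    using that adjoint_S_add by (metis domD option.sel)
  show "the (adjoint_op S (c *\<^sub>C u)) = c *\<^sub>C the (adjoint_op S u)"
    if "u \<in> dom (adjoint_op S)" for c u
    using that adjoint_S_scaleC by (metis domD option.sel)
qed

text \<open>Convergence in the graph norm means convergence of the vectors and of their images under
  \<open>adjoint_op S\<close>. The images under \<open>adjoint_op T\<close> then converge too, being
  the difference from \<open>B\<close>, so orthogonality to \<open>V\<close> passes to the
  limit.\<close>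

lemma closed_graph_subspace_domain:
  assumes V: "self_orthogonal_domain T S V"
  shows "closed_graph_subspace (adjoint_op S) V"
proof -
  note VD = self_orthogonal_domainD[OF V]
  interpret M: Metric_space "dom (adjoint_op S)" "\<lambda>u v. graph_norm (adjoint_op S) (u - v)"
    by (rule Metric_space_graph_norm[OF linear_adjoint_S])
  have S: "adjoint_op S u = Some (the (adjoint_op S u))" if "u \<in> dom (adjoint_op S)" for u
    using that by (metis domD option.sel)
  have "l \<in> V" if \<sigma>: "range \<sigma> \<subseteq> V" and lim: "limitin M.mtopology \<sigma> l sequentially" for \<sigma> l
  proof -
    have l: "l \<in> dom (adjoint_op S)"
      and N: "\<And>e. e > 0 \<Longrightarrow> \<exists>N. \<forall>n\<ge>N. graph_norm (adjoint_op S) (\<sigma> n - l) < e"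
      using lim unfolding M.limit_metric_sequentially by blast+
    have \<sigma>V: "\<sigma> n \<in> V" for n using \<sigma> by blast
    have \<sigma>S: "adjoint_op S (\<sigma> n) = Some (the (adjoint_op S (\<sigma> n)))" for n
      using \<sigma>V VD(3) S by blast
    have gn: "graph_norm (adjoint_op S) (\<sigma> n - l) =
        norm (\<sigma> n - l) + norm (the (adjoint_op S (\<sigma> n)) - the (adjoint_op S l))" for n
      using adjoint_S_diff[OF \<sigma>S S[OF l], of n] by (simp add: graph_norm_def)
    have \<sigma>l: "\<sigma> \<longlonglongrightarrow> l"
    proof (rule LIMSEQ_I)
      fix e :: real assume "e > 0"
      then obtain N where "\<forall>n\<ge>N. graph_norm (adjoint_op S) (\<sigma> n - l) < e" using N by blast
      then have "norm (\<sigma> n - l) < e" if "n \<ge> N" for n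
        using that le_less_trans[OF _ \<open>\<forall>n\<ge>N. _\<close>[rule_format, OF that]] by (simp add: gn)
      then show "\<exists>N. \<forall>n\<ge>N. norm (\<sigma> n - l) < e" by blast
    qed
    have S\<sigma>l: "(\<lambda>n. the (adjoint_op S (\<sigma> n))) \<longlonglongrightarrow> the (adjoint_op S l)"
    proof (rule LIMSEQ_I)
      fix e :: real assume "e > 0"
      then obtain N where "\<forall>n\<ge>N. graph_norm (adjoint_op S) (\<sigma> n - l) < e" using N by blast
      then have "norm (the (adjoint_op S (\<sigma> n)) - the (adjoint_op S l)) < e" if "n \<ge> N" for n
        using that le_less_trans[OF _ \<open>\<forall>n\<ge>N. _\<close>[rule_format, OF that]] by (simp add: gn)
      then show "\<exists>N. \<forall>n\<ge>N. norm (the (adjoint_op S (\<sigma> n)) - the (adjoint_op S l)) < e" by blast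
    qed
    have T: "adjoint_op T v = Some (B v - the (adjoint_op S v))" if "v \<in> dom (adjoint_op S)" for v
      using S[OF that] adjoint_S_eq by blast
    show "l \<in> V"
    proof (rule VD(5)[OF T[OF l]])
      fix u w assume u: "u \<in> V" "adjoint_op S u = Some w"
      have "cinner w (\<sigma> n) = cinner u (B (\<sigma> n) - the (adjoint_op S (\<sigma> n)))" for n
        by (rule VD(4)[OF u \<sigma>V T]) (use VD(3) \<sigma>V in blast)
      moreover have "(\<lambda>n. cinner w (\<sigma> n)) \<longlonglongrightarrow> cinner w l"
        by (intro cinner.tendsto tendsto_const \<sigma>l)
      moreover have "(\<lambda>n. cinner u (B (\<sigma> n) - the (adjoint_op S (\<sigma> n)))) \<longlonglongrightarrow>
          cinner u (B l - the (adjoint_op S l))"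
        by (intro cinner.tendsto tendsto_intros \<sigma>l S\<sigma>l)
      ultimately show "cinner w l = cinner u (B l - the (adjoint_op S l))"
        using LIMSEQ_unique by auto
    qed
  qed
  then show ?thesis
    using VD(1,3) by (auto simp: closed_graph_subspace_def M.metric_closedin_iff_sequentially_closed)
qed

text \<open>On \<open>ker (adjoint_op S)\<close> the boundary form
  \<open>cinner (adjoint_op S u) v - cinner u (adjoint_op T v)\<close> is the negative of the form of \<open>B\<close>, on
  \<open>ker (adjoint_op T)\<close> it is the form of \<open>B\<close> itself, and the two kernels are orthogonal for it.
  Hence it vanishes on the graph of a map between the kernels iff the map is isometric for the form
  of \<open>B\<close>.\<close>

lemma self_orthogonal_domain_graph:
  assumes J_add: "\<And>x y. \<lbrakk>x \<in> op_kernel (adjoint_op S); y \<in> op_kernel (adjoint_op S)\<rbrakk> \<Longrightarrow> J (x + y) = J x + J y"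
    and J_scale: "\<And>c x. x \<in> op_kernel (adjoint_op S) \<Longrightarrow> J (c *\<^sub>C x) = c *\<^sub>C J x"
    and J_iso: "\<And>x y. \<lbrakk>x \<in> op_kernel (adjoint_op S); y \<in> op_kernel (adjoint_op S)\<rbrakk> \<Longrightarrow>
      cinner (B (J x)) (J y) = cinner (B x) y"
    and J_onto: "J ` op_kernel (adjoint_op S) = op_kernel (adjoint_op T)"
  shows "\<exists>V. self_orthogonal_domain T S V \<and> fst ` G \<subseteq> V \<and>
    (\<forall>h. \<exists>v\<in>V. adjoint_op S v = Some h) \<and> (\<forall>h. \<exists>v\<in>V. adjoint_op T v = Some h)"
proof -
  define V where "V = {u + (a + J a) | u a. u \<in> fst ` G \<and> a \<in> op_kernel (adjoint_op S)}"
  interpret S: friedrichs_pair S T B m by (rule swap)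
  let ?K = "op_kernel (adjoint_op S)" and ?L = "op_kernel (adjoint_op T)"
  have K0: "0 \<in> ?K" by (rule complex_hilbert.subspace_0[OF csubspace_kernel])
  have J0: "J 0 = 0" using J_scale[OF K0, of 0] by simp
  have JL: "J a \<in> ?L" if "a \<in> ?K" for a using J_onto that by blast
  have S_ker: "adjoint_op S (a + J a) = Some (B (J a))" if "a \<in> ?K" for a
  proof -
    have "adjoint_op S a = Some 0" "adjoint_op S (J a) = Some (B (J a))"
      using that JL[OF that] by (auto simp: op_kernel_adjoint_S S.op_kernel_adjoint_S adjoint_T_eq)
    from adjoint_S_add[OF this] show ?thesis by simp
  qed
  have T_ker: "adjoint_op T (a + J a) = Some (B a)" if "a \<in> ?K" for a
    using S_ker[OF that] by (simp add: adjoint_S_eq blinfun.add_right)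
  have S_V: "adjoint_op S (u + (a + J a)) = Some (w + B (J a))" if "(u, w) \<in> G" "a \<in> ?K" for u w a
    by (rule adjoint_S_add[OF graph_closureD[OF that(1)] S_ker[OF that(2)]])
  have T_G: "adjoint_op T u = Some (B u - w)" if "(u, w) \<in> G" for u w
    by (rule S.graph_closureD[OF graph_closure_swap[OF that]])
  have T_V: "adjoint_op T (u + (a + J a)) = Some (B u - w + B a)" if "(u, w) \<in> G" "a \<in> ?K" for u w a
    by (rule S.adjoint_S_add[OF T_G[OF that(1)] T_ker[OF that(2)]])
  have VI: "u + (a + J a) \<in> V" if "(u, w) \<in> G" "a \<in> ?K" for u w a
    unfolding V_def using that by force
  have VE: "\<exists>u w a. (u, w) \<in> G \<and> a \<in> ?K \<and> v = u + (a + J a)" if "v \<in> V" for v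
    using that unfolding V_def by force
  \<comment> \<open>The values on \<open>V\<close> are \<open>w + B (J a)\<close>. As
    \<open>J a\<close> runs through the whole other kernel, \<open>decomposition\<close> reaches
    every \<open>h\<close>.\<close>
  have surj_S: "\<exists>v\<in>V. adjoint_op S v = Some h" for h
  proof -
    obtain u w b where h: "(u, w) \<in> G" "b \<in> ?L" "h = w + B b" using decomposition by blast
    then obtain a where "a \<in> ?K" "b = J a" using J_onto by blast
    with h show ?thesis using S_V VI by blast
  qed
  have surj_T: "\<exists>v\<in>V. adjoint_op T v = Some h" for h
  proof -
    obtain u w a where h: "(u, w) \<in> closure (Map.graph S)" "a \<in> ?K" "h = w + B a"
      using S.decomposition by blast
    then have "(u, B u - w) \<in> G" using S.graph_closure_swap by blast
    from T_V[OF this h(2)] VI[OF this h(2)] h(3) show ?thesis by auto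
  qed
  have orth: "cinner w' v = cinner v' z"
    if v': "v' \<in> V" "adjoint_op S v' = Some w'" and v: "v \<in> V" "adjoint_op T v = Some z" for v v' w' z
  proof -
    obtain u1 w1 a1 where 1: "(u1, w1) \<in> G" "a1 \<in> ?K" "v' = u1 + (a1 + J a1)" using VE v' by blast
    obtain u2 w2 a2 where 2: "(u2, w2) \<in> G" "a2 \<in> ?K" "v = u2 + (a2 + J a2)" using VE v by blast
    have w': "w' = w1 + B (J a1)" using S_V[OF 1(1,2)] v'(2) 1(3) by simp
    have z: "z = (B u2 - w2) + B a2" using T_V[OF 2(1,2)] v(2) 2(3) by simp
    have e1: "cinner w1 v = cinner u1 z" by (rule graph_closure_cinner[OF 1(1) v(2)])
    have e2: "cinner (B (J a1)) u2 = cinner (a1 + J a1) (B u2 - w2)"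
      using S.graph_closure_cinner[OF graph_closure_swap[OF 2(1)] S_ker[OF 1(2)]]
        cinner_commute[of u2 "B (J a1)"] cinner_commute[of "B u2 - w2" "a1 + J a1"] by simp
    \<comment> \<open>The mixed terms agree by symmetry of \<open>B\<close>, and the remaining two
      by the isometry of \<open>J\<close>.\<close>
    have e3: "cinner (B (J a1)) (a2 + J a2) = cinner (a1 + J a1) (B a2)"
      using J_iso[OF 1(2) 2(2)] by (simp add: cinner_add_left cinner_add_right B_sym)
    have "cinner w' v = cinner w1 v + (cinner (B (J a1)) u2 + cinner (B (J a1)) (a2 + J a2))"
      unfolding w' cinner_add_left 2(3) cinner_add_right by simp
    also have "\<dots> = cinner u1 z + (cinner (a1 + J a1) (B u2 - w2) + cinner (a1 + J a1) (B a2))"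
      by (simp only: e1 e2 e3)
    also have "\<dots> = cinner v' z"
      unfolding 1(3) cinner_add_left[of u1] z cinner_add_right by simp
    finally show ?thesis .
  qed
  have sub: "csubspace V"
  proof (rule complex_hilbert.subspaceI)
    show "0 \<in> V" using VI[OF zero_in_graph_closure K0] J0 by simp
  next
    fix x y assume "x \<in> V" "y \<in> V"
    then obtain u1 w1 a1 u2 w2 a2
      where 1: "(u1, w1) \<in> G" "a1 \<in> ?K" "x = u1 + (a1 + J a1)"
        and 2: "(u2, w2) \<in> G" "a2 \<in> ?K" "y = u2 + (a2 + J a2)" using VE by meson
    have "(u1 + u2, w1 + w2) \<in> G" using graph_closure_add[OF 1(1) 2(1)] by simp
    from VI[OF this complex_hilbert.subspace_add[OF csubspace_kernel 1(2) 2(2)]]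
    show "x + y \<in> V" using J_add[OF 1(2) 2(2)] 1(3) 2(3) by (simp add: algebra_simps)
  next
    fix c x assume "x \<in> V"
    then obtain u w a where 1: "(u, w) \<in> G" "a \<in> ?K" "x = u + (a + J a)" using VE by meson
    from VI[OF graph_closure_scaleC[OF 1(1)] complex_hilbert.subspace_scale[OF csubspace_kernel 1(2)]]
    show "c *\<^sub>C x \<in> V" using J_scale[OF 1(2)] 1(3) by (simp add: scaleC_add_right)
  qed
  have W0: "fst ` G \<subseteq> V" using VI[OF _ K0] J0 by auto
  have max: "v \<in> V" if z: "adjoint_op T v = Some z"
    and o: "\<And>u w. u \<in> V \<Longrightarrow> adjoint_op S u = Some w \<Longrightarrow> cinner w v = cinner u z" for v z
  proof -
    \<comment> \<open>Surjectivity yields maximality: \<open>v'\<close> in \<open>V\<close> has the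
      same image \<open>z\<close> as \<open>v\<close>, and testing both with a \<open>u\<close> in
      \<open>V\<close> that is mapped to \<open>v - v'\<close> shows that \<open>v - v'\<close> is
      orthogonal to itself.\<close>
    obtain v' where v': "v' \<in> V" "adjoint_op T v' = Some z" using surj_T by blast
    obtain u where u: "u \<in> V" "adjoint_op S u = Some (v - v')" using surj_S by blast
    have "cinner (v - v') (v - v') = 0"
      using o[OF u] orth[OF u v'] by (simp add: cinner.diff_right)
    then have "v = v'" by (simp add: cinner_self)
    with v' show ?thesis by simp
  qed
  have "self_orthogonal_domain T S V"
    unfolding self_orthogonal_domain_def
  proof (intro conjI allI iffI)
    show "csubspace V" "dom T \<subseteq> V" using sub W0 dom_subset_closure by auto
  next
    fix v assume v: "v \<in> V"
    then obtain z where "adjoint_op T v = Some z" using VE T_V by metis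
    with orth[OF _ _ v] show "\<exists>z. adjoint_op T v = Some z \<and>
        (\<forall>u\<in>V. \<forall>w. adjoint_op S u = Some w \<longrightarrow> cinner w v = cinner u z)"
      by blast
  next
    fix v assume "\<exists>z. adjoint_op T v = Some z \<and>
        (\<forall>u\<in>V. \<forall>w. adjoint_op S u = Some w \<longrightarrow> cinner w v = cinner u z)"
    then show "v \<in> V" using max by blast
  qed
  with surj_S surj_T W0 show ?thesis by blast
qed

text \<open>The pairs of kernel elements \<open>a\<close>, \<open>b\<close> with
  \<open>a + b \<in> V\<close> form a linear relation. It preserves the form of \<open>B\<close>
  because the boundary form vanishes on \<open>V\<close>; positivity makes it single-valued, and
  surjectivity of the two realisations makes it total and onto.\<close>

lemma kernel_isometry:
  assumes V: "csubspace V" "dom T \<subseteq> V"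
    and adj: "adjoint_op (adjoint_op S |` V) = adjoint_op T |` V"
    and bij: "bijective_from V (adjoint_op S |` V)" "bijective_from V (adjoint_op T |` V)"
  shows "\<exists>J. (\<forall>x\<in>op_kernel (adjoint_op S). \<forall>y\<in>op_kernel (adjoint_op S). J (x + y) = J x + J y) \<and>
    (\<forall>c. \<forall>x\<in>op_kernel (adjoint_op S). J (c *\<^sub>C x) = c *\<^sub>C J x) \<and>
    (\<forall>x\<in>op_kernel (adjoint_op S). \<forall>y\<in>op_kernel (adjoint_op S).
      cinner (B (J x)) (J y) = cinner (B x) y) \<and>
    J ` op_kernel (adjoint_op S) = op_kernel (adjoint_op T)"
proof -
  interpret S: friedrichs_pair S T B m by (rule swap)
  let ?K = "op_kernel (adjoint_op S)" and ?L = "op_kernel (adjoint_op T)"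
  have dom: "dom (adjoint_op S |` V) = V" "dom (adjoint_op T |` V) = V"
    using bij by (simp_all add: bijective_from_def)
  have surj: "\<exists>v\<in>V. R v = Some h" if R: "bijective_from V (R |` V)" for R :: "'a operator" and h
  proof -
    have "h \<in> (\<lambda>u. the ((R |` V) u)) ` V" using R by (auto simp: bijective_from_def bij_betw_def)
    then obtain v where v: "v \<in> V" "h = the ((R |` V) v)" by blast
    moreover have "v \<in> dom (R |` V)" using R v by (simp add: bijective_from_def)
    ultimately show ?thesis by (auto simp: restrict_map_def domIff)
  qed
  have dense_V: "closure (dom (adjoint_op S |` V)) = UNIV"
    unfolding dom using dense closure_mono[OF V(2)] by auto
  have orth: "cinner w u = cinner v z"
    if "v \<in> V" "adjoint_op S v = Some w" "u \<in> V" "adjoint_op T u = Some z" for v w u z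
  proof -
    have "adjoint_op (adjoint_op S |` V) u = Some z" by (simp add: adj that(3,4))
    then have "\<forall>v\<in>V. cinner (the ((adjoint_op S |` V) v)) u = cinner v z"
      unfolding adjoint_op_eq_Some_iff[OF dense_V] dom .
    from bspec[OF this that(1)] show ?thesis by (simp add: that(1,2))
  qed
  \<comment> \<open>At \<open>a + b\<close> only \<open>b\<close> contributes to
    \<open>adjoint_op S\<close>, with value \<open>B b\<close>; at \<open>a' + b'\<close> only
    \<open>a'\<close> contributes to \<open>adjoint_op T\<close>, with value \<open>B a'\<close>.
    The mixed terms cancel by symmetry.\<close>
  have iso: "cinner (B b) b' = cinner (B a) a'"
    if "a \<in> ?K" "b \<in> ?L" "a + b \<in> V" "a' \<in> ?K" "b' \<in> ?L" "a' + b' \<in> V" for a b a' b'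
  proof -
    have "adjoint_op S (a + b) = Some (0 + B b)"
      using that(1,2) by (intro adjoint_S_add)
        (auto simp: op_kernel_adjoint_S S.op_kernel_adjoint_S adjoint_T_eq)
    moreover have "adjoint_op T (a' + b') = Some (B a' + 0)"
      using that(4,5) by (intro S.adjoint_S_add)
        (auto simp: op_kernel_adjoint_S S.op_kernel_adjoint_S adjoint_S_eq)
    ultimately have "cinner (0 + B b) (a' + b') = cinner (a + b) (B a' + 0)"
      using that by (intro orth)
    then show ?thesis by (simp add: cinner_add_left cinner_add_right B_sym)
  qed
  have uniq: "b = b'" if "a \<in> ?K" "b \<in> ?L" "a + b \<in> V" "b' \<in> ?L" "a + b' \<in> V" for a b b'
  proof -
    have d: "b - b' \<in> ?L"
      by (rule complex_hilbert.subspace_diff[OF S.csubspace_kernel that(2,4)])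
    \<comment> \<open>The difference of the two sums pairs \<open>b - b'\<close> with the kernel
      element \<open>0\<close>, so \<open>iso\<close> makes the form of \<open>B\<close> vanish at
      \<open>b - b'\<close>.\<close>
    have "0 + (b - b') \<in> V" using complex_hilbert.subspace_diff[OF V(1) that(3,5)] by simp
    from iso[OF _ d this _ d this] complex_hilbert.subspace_0[OF csubspace_kernel]
    have "cinner (B (b - b')) (b - b') = 0" by (simp add: blinfun.zero_right cinner.zero_left)
    then have "m * (norm (b - b'))\<^sup>2 \<le> 0" using B_pos[of "b - b'"] by simp
    then show ?thesis using m_pos by (simp add: mult_le_0_iff)
  qed
  have "\<exists>b. b \<in> ?L \<and> a + b \<in> V" if a: "a \<in> ?K" for a
  proof -
    have Ta: "adjoint_op T a = Some (B a)"
      using a by (simp add: op_kernel_adjoint_S adjoint_S_eq)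
    obtain v where v: "v \<in> V" "adjoint_op T v = Some (B a)" using surj[OF bij(2)] by blast
    from S.adjoint_S_diff[OF v(2) Ta] have "v - a \<in> ?L" by (simp add: S.op_kernel_adjoint_S)
    moreover have "a + (v - a) \<in> V" using v by simp
    ultimately show ?thesis by blast
  qed
  then obtain J where J: "\<And>a. a \<in> ?K \<Longrightarrow> J a \<in> ?L" "\<And>a. a \<in> ?K \<Longrightarrow> a + J a \<in> V" by metis
  have "J (x + y) = J x + J y" if "x \<in> ?K" "y \<in> ?K" for x y
  proof (rule uniq)
    show xy: "x + y \<in> ?K" by (rule complex_hilbert.subspace_add[OF csubspace_kernel that])
    show "J (x + y) \<in> ?L" "x + y + J (x + y) \<in> V" using J xy by auto
    show "J x + J y \<in> ?L"
      by (intro complex_hilbert.subspace_add[OF S.csubspace_kernel] J that)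
    show "x + y + (J x + J y) \<in> V"
      using complex_hilbert.subspace_add[OF V(1) J(2)[OF that(1)] J(2)[OF that(2)]]
      by (simp add: algebra_simps)
  qed
  moreover have "J (c *\<^sub>C x) = c *\<^sub>C J x" if "x \<in> ?K" for c x
  proof (rule uniq)
    show cx: "c *\<^sub>C x \<in> ?K" by (rule complex_hilbert.subspace_scale[OF csubspace_kernel that])
    show "J (c *\<^sub>C x) \<in> ?L" "c *\<^sub>C x + J (c *\<^sub>C x) \<in> V" using J cx by auto
    show "c *\<^sub>C J x \<in> ?L" by (intro complex_hilbert.subspace_scale[OF S.csubspace_kernel] J that)
    show "c *\<^sub>C x + c *\<^sub>C J x \<in> V"
      using complex_hilbert.subspace_scale[OF V(1) J(2)[OF that]] by (simp add: scaleC_add_right)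
  qed
  moreover have "cinner (B (J x)) (J y) = cinner (B x) y" if "x \<in> ?K" "y \<in> ?K" for x y
    by (intro iso J that)
  moreover have "J ` ?K = ?L"
  proof
    show "J ` ?K \<subseteq> ?L" using J by blast
    show "?L \<subseteq> J ` ?K"
    proof
      fix b assume b: "b \<in> ?L"
      then have Sb: "adjoint_op S b = Some (B b)" by (simp add: S.op_kernel_adjoint_S adjoint_T_eq)
      \<comment> \<open>\<open>v\<close> and \<open>b\<close> have the same image under
        \<open>adjoint_op S\<close>, so \<open>v - b\<close> lies in the first kernel and is paired
        with \<open>b\<close>.\<close>
      obtain v where v: "v \<in> V" "adjoint_op S v = Some (B b)" using surj[OF bij(1)] by blast
      from adjoint_S_diff[OF v(2) Sb] have a: "v - b \<in> ?K" by (simp add: op_kernel_adjoint_S)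
      have "J (v - b) = b" by (rule uniq[OF a J(1)[OF a] J(2)[OF a] b]) (use v in simp)
      with a show "b \<in> J ` ?K" by force
    qed
  qed
  ultimately show ?thesis by (intro exI[of _ J] conjI ballI allI) simp_all
qed

end

theorem corollary3p12:
  fixes T0 T0' T1 T1' :: "'a::complex_hilbert operator" and W0 :: "'a set"
  assumes "joint_abstract_friedrichs T0 T0'"
    and "T1 = adjoint_op T0'"
    and "T1' = adjoint_op T0"
    and "W0 = dom (closure_op T0)"
  shows "(\<exists>V. closed_graph_subspace T1 V \<and> W0 \<subseteq> V \<and>
            mutually_adjoint (T1 |` V) (T1' |` V) \<and>
            bijective_from V (T1 |` V) \<and> bijective_from V (T1' |` V))
         \<longleftrightarrow> isomorphic_subspaces (op_kernel T1) (op_kernel T1')"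
proof -
  obtain B m where "friedrichs_pair T0 T0' B m"
    using joint_abstract_friedrichs_bounded_sum[OF assms(1)] by blast
  then interpret friedrichs_pair T0 T0' B m .
  interpret S: friedrichs_pair T0' T0 B m by (rule swap)
  \<comment> \<open>Both directions can thus work with a bijection of the kernels that preserves the
    form of \<open>B\<close> instead of the norm.\<close>
  note iso_iff = isomorphic_subspaces_form_iff[OF m_pos B_pos B_sym csubspace_kernel closed_kernel
      S.csubspace_kernel S.closed_kernel]
  show ?thesis
    unfolding assms(2-4) dom_closure_op iso_iff
  proof (intro iffI; elim exE conjE)
    fix V
    assume "closed_graph_subspace (adjoint_op T0') V" "fst ` G \<subseteq> V"
      "mutually_adjoint (adjoint_op T0' |` V) (adjoint_op T0 |` V)"
      "bijective_from V (adjoint_op T0' |` V)" "bijective_from V (adjoint_op T0 |` V)"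
    then show "\<exists>J. (\<forall>x\<in>op_kernel (adjoint_op T0'). \<forall>y\<in>op_kernel (adjoint_op T0'). J (x + y) = J x + J y) \<and>
      (\<forall>c. \<forall>x\<in>op_kernel (adjoint_op T0'). J (c *\<^sub>C x) = c *\<^sub>C J x) \<and>
      (\<forall>x\<in>op_kernel (adjoint_op T0'). \<forall>y\<in>op_kernel (adjoint_op T0').
        cinner (B (J x)) (J y) = cinner (B x) y) \<and>
      J ` op_kernel (adjoint_op T0') = op_kernel (adjoint_op T0)"
      using dom_subset_closure
      by (intro kernel_isometry[of V]) (auto simp: closed_graph_subspace_def mutually_adjoint_def)
  next
    fix J
    assume J: "\<forall>x\<in>op_kernel (adjoint_op T0'). \<forall>y\<in>op_kernel (adjoint_op T0'). J (x + y) = J x + J y"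
      "\<forall>c. \<forall>x\<in>op_kernel (adjoint_op T0'). J (c *\<^sub>C x) = c *\<^sub>C J x"
      "\<forall>x\<in>op_kernel (adjoint_op T0'). \<forall>y\<in>op_kernel (adjoint_op T0').
        cinner (B (J x)) (J y) = cinner (B x) y"
      "J ` op_kernel (adjoint_op T0') = op_kernel (adjoint_op T0)"
    obtain V where V: "self_orthogonal_domain T0 T0' V" "fst ` G \<subseteq> V"
        "\<And>h. \<exists>v\<in>V. adjoint_op T0' v = Some h" "\<And>h. \<exists>v\<in>V. adjoint_op T0 v = Some h"
      using self_orthogonal_domain_graph[of J] J by auto
    \<comment> \<open>The swapped pair provides the second adjoint identity and the bijectivity of
      the other realisation.\<close>
    note V' = self_orthogonal_domain_swap[OF V(1)]
    show "\<exists>V. closed_graph_subspace (adjoint_op T0') V \<and> fst ` G \<subseteq> V \<and>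
      mutually_adjoint (adjoint_op T0' |` V) (adjoint_op T0 |` V) \<and>
      bijective_from V (adjoint_op T0' |` V) \<and> bijective_from V (adjoint_op T0 |` V)"
      unfolding mutually_adjoint_def
      by (intro exI[of _ V] conjI closed_graph_subspace_domain[OF V(1)] V(2)
          adjoint_restrict[OF V(1)] S.adjoint_restrict[OF V']
          bijective_from_restrict[OF V(1,3)] S.bijective_from_restrict[OF V' V(4)])
  qed
qed

end
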